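(* Let $\mu$ be the standard Gaussian measure on $W=H=\mathbb{R}^d$, let $f:\mathbb{R}^d\to\mathbb{R}$ be a smooth function such that $d\nu=(E[e^{-f}])^{-1}e^{-f}d\mu$ is a probability measure with finite relative entropy $H(\nu|\mu)$, and let $\varphi$ be the (forward) Monge potential with $(I_W+\nabla\varphi)\mu=\nu$, assumed to be smooth. Then $$\nabla\varphi+\nabla f\circ(I_W+\nabla\varphi)-\delta\left[(I_H+\nabla^2\varphi)^{-1}-I_H\right]=0$$ almost surely.
   Context: The forward Monge potential $\varphi$ is the function, unique up to an additive constant, such that $x\mapsto\frac12|x|^2+\varphi(x)$ is convex and $T=I_W+\nabla\varphi$ is the optimal transport map from $\mu$ to $\nu$ for the quadratic cost $|x-y|^2$. $\delta$ denotes the Gaussian divergence, i.e. the adjoint of $\nabla$ with respect to $\mu$; for a vector field $\xi$, $\delta\xi(x)=(x,\xi(x))-\mathrm{div}\,\xi(x)$, and for a (Hilbert-Schmidt) operator-valued map $M$, $\delta M$ is the vector field determined by $E[(\delta M,\xi)]=E[\mathrm{trace}(M\cdot\nabla\xi)]$ (for symmetric $M$: $(\delta M,h)=\delta(Mh)$ for every fixed $h$). $E$ is expectation with respect to $\mu$. *)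

theory Defs
  imports "HOL-Probability.Probability"
begin

primrec k_times_differentiable ::
    "nat \<Rightarrow> ('a::real_normed_vector \<Rightarrow> 'b::real_normed_vector) \<Rightarrow> bool" where
  "k_times_differentiable 0 g \<longleftrightarrow> continuous_on UNIV g"
| "k_times_differentiable (Suc k) g \<longleftrightarrow>
     g differentiable_on UNIV \<and>
     (\<forall>v. k_times_differentiable k (\<lambda>x. frechet_derivative g (at x) v))"

text \<open>On a finite-dimensional domain this is the class of infinitely differentiable functions.\<close>

definition smooth :: "('a::real_normed_vector \<Rightarrow> 'b::real_normed_vector) \<Rightarrow> bool" where
  "smooth g \<longleftrightarrow> (\<forall>k. k_times_differentiable k g)"

definition grad :: "('a::real_inner \<Rightarrow> real) \<Rightarrow> 'a \<Rightarrow> 'a" where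
  "grad g x = (THE D. GDERIV g x :> D)"

lemma grad_eqI: "GDERIV g x :> D \<Longrightarrow> grad g x = D"
proof -
  assume D: "GDERIV g x :> D"
  have "D' = D" if "GDERIV g x :> D'" for D'
  proof -
    have "(\<lambda>h. inner h D') = (\<lambda>h. inner h D)"
      using has_derivative_unique that D unfolding gderiv_def by blast
    then have "inner (D' - D) D' = inner (D' - D) D" by (rule fun_cong)
    then have "inner (D' - D) (D' - D) = 0" by (simp add: inner_diff_right)
    then show ?thesis by simp
  qed
  with D show ?thesis unfolding grad_def by blast
qed

lemma GDERIV_grad:
  fixes g :: "'a::euclidean_space \<Rightarrow> real"
  assumes "g differentiable at x"
  shows "GDERIV g x :> grad g x"
proof -
  let ?g' = "frechet_derivative g (at x)"
  have d: "(g has_derivative ?g') (at x)"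
    using assms by (simp add: frechet_derivative_works)
  then have "linear ?g'" by (rule has_derivative_linear)
  then have "?g' h = inner h (adjoint ?g' 1)" for h
    using adjoint_works[of ?g' h 1] by simp
  then have "?g' = (\<lambda>h. inner h (adjoint ?g' 1))" by auto
  with d have "GDERIV g x :> adjoint ?g' 1" by (simp add: gderiv_def)
  then show ?thesis by (simp add: grad_eqI)
qed

definition hessian :: "(real^'n \<Rightarrow> real) \<Rightarrow> real^'n \<Rightarrow> real^'n^'n" where
  "hessian g x = jacobian (grad g) (at x)"

definition std_gaussian :: "(real^'n) measure" where
  "std_gaussian = density lborel (\<lambda>x. ennreal (\<Prod>i\<in>UNIV. std_normal_density (x $ i)))"

text \<open>
  The measure with density \<open>exp (- f) / E[exp (- f)]\<close> with respect to the Gaussian measure. If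
  \<open>exp (- f)\<close> is not integrable, the Bochner integral and hence the quotient are 0, so that
  this is the null measure; it is a probability measure exactly when \<open>exp (- f)\<close> is integrable
  (for measurable \<open>f\<close>).
\<close>

definition gibbs :: "(real^'n \<Rightarrow> real) \<Rightarrow> (real^'n) measure" where
  "gibbs f = density std_gaussian
     (\<lambda>x. ennreal (exp (- f x) / (\<integral>y. exp (- f y) \<partial>std_gaussian)))"

text \<open>
  The relative entropy of \<open>\<nu>\<close> with respect to \<open>\<mu>\<close> is the integral of
  \<open>ln (d\<nu>/d\<mu>)\<close> with respect to \<open>\<nu>\<close>, and infinite if \<open>\<nu>\<close> is not absolutely continuous. For
  probability measures the negative part of the integrand is always integrable, so finiteness is
  integrability. (A bound on \<open>KL_divergence\<close> would not express this, as it
  is 0 for a non-integrable integrand.)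
\<close>

definition finite_relative_entropy :: "'a measure \<Rightarrow> 'a measure \<Rightarrow> bool" where
  "finite_relative_entropy \<nu> \<mu> \<longleftrightarrow>
     absolutely_continuous \<mu> \<nu> \<and> integrable \<nu> (entropy_density (exp 1) \<mu> \<nu>)"

definition transport_map ::
    "'a::euclidean_space measure \<Rightarrow> 'a measure \<Rightarrow> ('a \<Rightarrow> 'a) \<Rightarrow> bool" where
  "transport_map \<mu> \<nu> T \<longleftrightarrow> T \<in> measurable \<mu> borel \<and> distr \<mu> borel T = \<nu>"

definition optimal_transport_map ::
    "'a::euclidean_space measure \<Rightarrow> 'a measure \<Rightarrow> ('a \<Rightarrow> 'a) \<Rightarrow> bool" where
  "optimal_transport_map \<mu> \<nu> T \<longleftrightarrow>
     transport_map \<mu> \<nu> T \<and>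
     (\<forall>S. transport_map \<mu> \<nu> S \<longrightarrow>
        (\<integral>\<^sup>+x. ennreal ((norm (x - T x))\<^sup>2) \<partial>\<mu>) \<le> (\<integral>\<^sup>+x. ennreal ((norm (x - S x))\<^sup>2) \<partial>\<mu>))"

definition Monge_potential ::
    "'a::euclidean_space measure \<Rightarrow> 'a measure \<Rightarrow> ('a \<Rightarrow> real) \<Rightarrow> bool" where
  "Monge_potential \<mu> \<nu> \<phi> \<longleftrightarrow>
     convex_on UNIV (\<lambda>x. (norm x)\<^sup>2 / 2 + \<phi> x) \<and>
     optimal_transport_map \<mu> \<nu> (\<lambda>x. x + grad \<phi> x)"

definition gauss_div :: "(real^'n \<Rightarrow> real^'n) \<Rightarrow> real^'n \<Rightarrow> real" where
  "gauss_div \<xi> x = inner x (\<xi> x) - trace (jacobian \<xi> (at x))"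

text \<open>
  The divergence of a matrix field: the vector field whose inner product with any fixed vector
  \<open>h\<close> is the divergence of \<open>M h\<close>. Lemma \<open>inner_gauss_div_matrix\<close> below shows that
  prescribing this for the coordinate vectors suffices.
\<close>

definition gauss_div_matrix :: "(real^'n \<Rightarrow> real^'n^'n) \<Rightarrow> real^'n \<Rightarrow> real^'n" where
  "gauss_div_matrix M x = (\<chi> j. gauss_div (\<lambda>y. M y *v axis j 1) x)"

lemma inner_gauss_div_matrix:
  fixes M :: "real^'n \<Rightarrow> real^'n^'n"
  assumes "M differentiable at x"
  shows "inner (gauss_div_matrix M x) h = gauss_div (\<lambda>y. M y *v h) x"
proof -
  obtain M' where M': "(M has_derivative M') (at x)"
    using assms by (auto simp: differentiable_def)
  have bl: "bounded_linear (\<lambda>A. A *v u)" for u :: "real^'n"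
    unfolding linear_conv_bounded_linear[symmetric]
    by (simp add: linear_iff matrix_vector_mult_add_rdistrib
        scaleR_matrix_vector_assoc)
  have "frechet_derivative (\<lambda>y. M y *v u) (at x) = (\<lambda>v. M' v *v u)" for u
    using frechet_derivative_at[OF bounded_linear.has_derivative[OF bl M']] by simp
  then have div: "gauss_div (\<lambda>y. M y *v u) x =
      inner x (M x *v u) - (\<Sum>i\<in>UNIV. (M' (axis i 1) *v u) $ i)" for u
    by (simp add: gauss_div_def trace_def jacobian_def matrix_def)
  let ?F = "\<lambda>u. inner x (M x *v u) - (\<Sum>i\<in>UNIV. (M' (axis i 1) *v u) $ i)"
  have lin: "linear ?F"
    by (auto simp: linear_iff matrix_vector_right_distrib matrix_vector_mult_scaleR
        inner_add_right sum.distrib sum_distrib_left right_diff_distrib)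
  have "?F h = ?F (\<Sum>j\<in>UNIV. h $ j *\<^sub>R axis j 1)"
    by (simp add: basis_expansion scalar_mult_eq_scaleR[symmetric])
  also have "\<dots> = (\<Sum>j\<in>UNIV. h $ j * ?F (axis j 1))"
    unfolding linear_sum[OF lin] linear_cmul[OF lin] by simp
  finally show ?thesis
    unfolding div by (simp add: gauss_div_matrix_def div inner_vec_def mult.commute)
qed

end

theory Submission
  imports Defs
begin

text \<open>
  The equation is the logarithmic derivative of a Monge--Ampere equation. Write
  \<open>u x = \<bar>x\<bar>\<^sup>2 / 2 + \<phi> x\<close>, \<open>G = \<nabla>u = I + \<nabla>\<phi>\<close> for the transport map and \<open>A = I + \<nabla>\<^sup>2\<phi>\<close> for its
  derivative. If \<open>G\<close> carries \<open>p dx\<close> to \<open>q dx\<close>, the change of variables formula should give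
  \<open>p = \<bar>det A\<bar> (q \<circ> G)\<close>. With \<open>p\<close> the Gaussian density and \<open>q = p e\<^sup>-\<^sup>f / Z\<close>, taking logarithms and
  differentiating turns this into \<open>A (\<nabla>f \<circ> G + G) = x + w\<close>, where \<open>w\<^sub>k = trace ((\<partial>\<^sub>k A) A\<^sup>-\<^sup>1)\<close> comes from
  Jacobi's formula for the determinant. Hence \<open>\<nabla>f \<circ> G + G = A\<^sup>-\<^sup>1 x + A\<^sup>-\<^sup>1 w\<close>. On the other
  side, \<open>\<delta> (A\<^sup>-\<^sup>1 - I)\<close> is \<open>A\<^sup>-\<^sup>1 x - x\<close> minus the Euclidean divergence of \<open>A\<^sup>-\<^sup>1\<close>, and since
  \<open>\<partial>\<^sub>i A\<^sup>-\<^sup>1 = - A\<^sup>-\<^sup>1 (\<partial>\<^sub>i A) A\<^sup>-\<^sup>1\<close> and the third derivatives of \<open>\<phi>\<close> are symmetric, that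
  divergence is \<open>- A\<^sup>-\<^sup>1 w\<close> (\<open>contracted_derivative_of_inverse\<close>). Subtracting \<open>x\<close> from both
  expressions yields the claim (\<open>Euler_Lagrange_at_regular_point\<close>).

  Two points need care, because \<open>A\<close> is only known to be positive semidefinite. First, \<open>A\<close>
  is invertible almost everywhere: the critical values of \<open>G\<close> form a Lebesgue null set by Sard's
  theorem, the image measure has a density and does not charge that set, so its preimage, which contains all
  critical points, is null for the Gaussian measure (\<open>pushforward_regular_points\<close>). Second, the
  change of variables formula needs injectivity, and the push-forward condition needs that the
  preimage of \<open>G K\<close> is \<open>K\<close> itself. Both follow from convexity of \<open>u\<close>: a fibre of \<open>\<nabla>u\<close> is the set
  of minimum points of \<open>u\<close> minus a linear function, so it is convex, and if it contained a regular point
  and another point, \<open>G\<close> would be constant on the segment joining them, against the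
  invertibility of its derivative (\<open>convex_gradient_injective_at_regular_point\<close>). Therefore the
  two measures can be compared on every box of regular points, which gives the
  Monge--Ampere equation at each regular point (\<open>Monge_Ampere_at_regular_point\<close>).
\<close>

section \<open>Gradients, Hessians and the symmetry of higher derivatives\<close>

lemma smooth_imp_differentiable:
  assumes "smooth g"
  shows "g differentiable (at x)"
proof -
  have "k_times_differentiable (Suc 0) g"
    using assms unfolding smooth_def by blast
  then show ?thesis
    by (simp add: differentiable_on_def)
qed

lemma smooth_frechet_derivative:
  assumes "smooth g"
  shows "smooth (\<lambda>x. frechet_derivative g (at x) v)"
  unfolding smooth_def
proof
  fix k
  have "k_times_differentiable (Suc k) g"
    using assms unfolding smooth_def by blast
  then show "k_times_differentiable k (\<lambda>x. frechet_derivative g (at x) v)"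
    by simp
qed

lemma smooth_imp_continuous_on:
  assumes "smooth g"
  shows "continuous_on S g"
  by (intro continuous_at_imp_continuous_on ballI differentiable_imp_continuous_within
      smooth_imp_differentiable assms)

lemma inner_grad:
  fixes g :: "'a::euclidean_space \<Rightarrow> real"
  assumes "g differentiable (at x)"
  shows "inner (grad g x) v = frechet_derivative g (at x) v"
proof -
  have "(g has_derivative (\<lambda>h. inner h (grad g x))) (at x)"
    using GDERIV_grad[OF assms] by (simp add: gderiv_def)
  from frechet_derivative_at[OF this, symmetric] show ?thesis
    by (simp add: inner_commute)
qed

lemma grad_nth:
  fixes g :: "real^'n \<Rightarrow> real"
  assumes "g differentiable (at x)"
  shows "grad g x $ i = frechet_derivative g (at x) (axis i 1)"
  using inner_grad[OF assms, of "axis i 1"] by (simp add: inner_axis)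

lemma has_derivative_grad:
  fixes g :: "'a::euclidean_space \<Rightarrow> real"
  assumes "smooth g"
  shows "(g has_derivative (\<lambda>h. inner (grad g x) h)) (at x)"
  using GDERIV_grad[OF smooth_imp_differentiable[OF assms]]
  by (simp add: gderiv_def inner_commute)

lemma has_derivative_grad_hessian:
  fixes g :: "real^'n \<Rightarrow> real"
  assumes "smooth g"
  shows "(grad g has_derivative (\<lambda>h. hessian g x *v h)) (at x)"
proof -
  have "grad g differentiable (at x)"
    unfolding differentiable_componentwise_within[where f = "grad g"]
    by (simp add: inner_grad smooth_imp_differentiable smooth_frechet_derivative assms)
  then show ?thesis
    by (simp add: jacobian_works hessian_def)
qed

lemma hessian_nth:
  fixes g :: "real^'n \<Rightarrow> real"
  assumes "smooth g"
  shows "hessian g x $ i $ j =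
    frechet_derivative (\<lambda>y. frechet_derivative g (at y) (axis i 1)) (at x) (axis j 1)"
proof -
  have "((\<lambda>y. grad g y $ i) has_derivative (\<lambda>h. (hessian g x *v h) $ i)) (at x)"
    by (rule bounded_linear.has_derivative[OF bounded_linear_vec_nth
          has_derivative_grad_hessian[OF assms]])
  then have "frechet_derivative (\<lambda>y. grad g y $ i) (at x) = (\<lambda>h. (hessian g x *v h) $ i)"
    by (rule frechet_derivative_at[symmetric])
  moreover have "(\<lambda>y. grad g y $ i) = (\<lambda>y. frechet_derivative g (at y) (axis i 1))"
    by (simp add: grad_nth smooth_imp_differentiable[OF assms])
  ultimately show ?thesis
    by (simp add: matrix_vector_mult_basis column_def)
qed

lemma DERIV_along_line:
  fixes h :: "'a::real_normed_vector \<Rightarrow> real"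
  assumes "smooth h"
  shows "((\<lambda>t. h (z + t *\<^sub>R u)) has_real_derivative frechet_derivative h (at (z + t *\<^sub>R u)) u) (at t)"
proof -
  have h: "(h has_derivative frechet_derivative h (at (z + t *\<^sub>R u))) (at (z + t *\<^sub>R u))"
    using smooth_imp_differentiable[OF assms] by (simp add: frechet_derivative_works)
  have "((\<lambda>t. z + t *\<^sub>R u) has_derivative (\<lambda>k. k *\<^sub>R u)) (at t)"
    by (auto intro!: derivative_eq_intros)
  from diff_chain_at[OF this h]
  have "((\<lambda>t. h (z + t *\<^sub>R u)) has_derivative
      (\<lambda>k. frechet_derivative h (at (z + t *\<^sub>R u)) (k *\<^sub>R u))) (at t)"
    by (simp add: o_def)
  then show ?thesis
    by (rule has_derivative_imp_has_field_derivative)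
      (simp add: linear_cmul[OF has_derivative_linear[OF h]])
qed

text \<open>
  Two applications of the mean value theorem: first along \<open>v\<close> to the increment of \<open>g\<close> in direction
  \<open>w\<close>, then along \<open>w\<close> to the derivative of \<open>g\<close> in direction \<open>v\<close>. The left-hand side is symmetric
  in \<open>v\<close> and \<open>w\<close>, while the right-hand side is not; this is what forces the symmetry of
  second derivatives.
\<close>

lemma second_difference_mean_value:
  fixes g :: "'a::real_normed_vector \<Rightarrow> real"
  assumes g: "smooth g" and s: "0 < s"
  shows "\<exists>z. norm (z - x) \<le> s * (norm v + norm w) \<and>
    g (x + s *\<^sub>R v + s *\<^sub>R w) - g (x + s *\<^sub>R v) - g (x + s *\<^sub>R w) + g x =
    s * s * frechet_derivative (\<lambda>y. frechet_derivative g (at y) v) (at z) w"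
proof -
  let ?F = "\<lambda>t. g (x + s *\<^sub>R w + t *\<^sub>R v) - g (x + t *\<^sub>R v)"
  define G where "G = (\<lambda>y. frechet_derivative g (at y) v)"
  have G: "smooth G"
    unfolding G_def by (rule smooth_frechet_derivative[OF g])
  have F: "(?F has_real_derivative G (x + s *\<^sub>R w + t *\<^sub>R v) - G (x + t *\<^sub>R v)) (at t)" for t
    unfolding G_def by (intro DERIV_diff DERIV_along_line g)
  obtain a where a: "0 < a" "a < s"
    "?F s - ?F 0 = (s - 0) * (G (x + s *\<^sub>R w + a *\<^sub>R v) - G (x + a *\<^sub>R v))"
    using MVT2[OF s F] by blast
  obtain b where b: "0 < b" "b < s"
    "G (x + a *\<^sub>R v + s *\<^sub>R w) - G (x + a *\<^sub>R v + 0 *\<^sub>R w) =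
     (s - 0) * frechet_derivative G (at (x + a *\<^sub>R v + b *\<^sub>R w)) w"
    using MVT2[OF s DERIV_along_line[OF G]] by blast
  let ?z = "x + a *\<^sub>R v + b *\<^sub>R w"
  have comm: "x + s *\<^sub>R w + s *\<^sub>R v = x + s *\<^sub>R v + s *\<^sub>R w"
    "x + s *\<^sub>R w + a *\<^sub>R v = x + a *\<^sub>R v + s *\<^sub>R w"
    by simp_all
  have "norm (?z - x) \<le> norm (a *\<^sub>R v) + norm (b *\<^sub>R w)"
    using norm_triangle_ineq[of "a *\<^sub>R v" "b *\<^sub>R w"] by (simp add: add.assoc)
  also have "\<dots> \<le> s * norm v + s * norm w"
    using a b by (auto intro!: add_mono mult_right_mono)
  finally have "norm (?z - x) \<le> s * (norm v + norm w)"
    by (simp add: distrib_left)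
  moreover have "?F s - ?F 0 = s * (s * frechet_derivative G (at ?z) w)"
    using a(3) b(3) unfolding comm by simp
  then have "g (x + s *\<^sub>R v + s *\<^sub>R w) - g (x + s *\<^sub>R v) - g (x + s *\<^sub>R w) + g x =
      s * s * frechet_derivative G (at ?z) w"
    unfolding comm by simp
  ultimately show ?thesis
    unfolding G_def by blast
qed

lemma second_derivative_symmetric:
  fixes g :: "'a::real_normed_vector \<Rightarrow> real"
  assumes g: "smooth g"
  shows "frechet_derivative (\<lambda>y. frechet_derivative g (at y) v) (at x) w =
    frechet_derivative (\<lambda>y. frechet_derivative g (at y) w) (at x) v"
proof -
  define D where "D = (\<lambda>v w z. frechet_derivative (\<lambda>y. frechet_derivative g (at y) v) (at z) w)"
  define q where "q = (\<lambda>v w s. (g (x + s *\<^sub>R v + s *\<^sub>R w) - g (x + s *\<^sub>R v) - g (x + s *\<^sub>R w) + g x) / (s * s))"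
  define s where "s = (\<lambda>n. inverse (real (Suc n)))"
  have pos: "0 < s n" for n
    by (simp add: s_def)
  have s0: "s \<longlonglongrightarrow> 0"
    unfolding s_def by (rule LIMSEQ_inverse_real_of_nat)
  have lim: "(\<lambda>n. q v w (s n)) \<longlonglongrightarrow> D v w x" for v w
  proof -
    have "\<exists>z. norm (z - x) \<le> s n * (norm v + norm w) \<and> q v w (s n) = D v w z" for n
      using second_difference_mean_value[OF g pos[of n], of x v w] pos[of n]
      unfolding q_def D_def by (auto simp: divide_simps)
    then obtain z where z: "\<And>n. norm (z n - x) \<le> s n * (norm v + norm w)"
      and q: "\<And>n. q v w (s n) = D v w (z n)"
      by metis
    have "(\<lambda>n. s n * (norm v + norm w)) \<longlonglongrightarrow> 0"
      using tendsto_mult_left_zero[OF s0] .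
    then have "(\<lambda>n. z n - x) \<longlonglongrightarrow> 0"
      by (rule Lim_null_comparison[rotated]) (simp add: z)
    then have "z \<longlonglongrightarrow> x"
      by (rule LIM_zero_cancel)
    moreover have "isCont (D v w) x"
      unfolding D_def
      using smooth_imp_continuous_on[where S = UNIV,
          OF smooth_frechet_derivative[OF smooth_frechet_derivative[OF g]]]
      by (simp add: continuous_on_eq_continuous_at)
    ultimately have "(\<lambda>n. D v w (z n)) \<longlonglongrightarrow> D v w x"
      by (rule isCont_tendsto_compose[rotated])
    then show ?thesis
      unfolding q .
  qed
  have comm: "x + t *\<^sub>R w + t *\<^sub>R v = x + t *\<^sub>R v + t *\<^sub>R w" for t
    by simp
  have "q w v t = q v w t" for t
    unfolding q_def comm[of t] by simp
  then have "D v w x = D w v x"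
    using LIMSEQ_unique[OF lim[of v w]] lim[of w v] by simp
  then show ?thesis
    by (simp add: D_def)
qed

lemma symmetric_hessian:
  fixes g :: "real^'n \<Rightarrow> real"
  assumes "smooth g"
  shows "transpose (hessian g x) = hessian g x"
proof -
  have "hessian g x $ j $ i = hessian g x $ i $ j" for i j
    unfolding hessian_nth[OF assms] by (rule second_derivative_symmetric[OF assms])
  then show ?thesis
    by (simp add: vec_eq_iff transpose_def)
qed

definition hessian_derivative :: "(real^'n \<Rightarrow> real) \<Rightarrow> real^'n \<Rightarrow> real^'n \<Rightarrow> real^'n^'n" where
  "hessian_derivative g x h = frechet_derivative (hessian g) (at x) h"

lemma smooth_hessian_nth:
  assumes "smooth g"
  shows "smooth (\<lambda>x. hessian g x $ i $ j)"
  unfolding hessian_nth[OF assms] by (intro smooth_frechet_derivative assms)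

lemma has_derivative_hessian:
  assumes "smooth g"
  shows "(hessian g has_derivative hessian_derivative g x) (at x)"
proof -
  have "hessian g differentiable (at x)"
    unfolding differentiable_componentwise_within[where f = "hessian g"]
    by (auto simp: Basis_vec_def inner_axis smooth_imp_differentiable smooth_hessian_nth assms)
  then show ?thesis
    by (simp add: hessian_derivative_def[abs_def] frechet_derivative_works)
qed

lemma hessian_derivative_nth:
  assumes "smooth g"
  shows "hessian_derivative g x h $ i $ j = frechet_derivative (\<lambda>y. hessian g y $ i $ j) (at x) h"
proof -
  have "((\<lambda>y. hessian g y $ i $ j) has_derivative (\<lambda>h. hessian_derivative g x h $ i $ j)) (at x)"
    by (intro bounded_linear.has_derivative[OF bounded_linear_vec_nth] has_derivative_hessian assms)
  from frechet_derivative_at[OF this, symmetric] show ?thesis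
    by simp
qed

text \<open>
  The third derivatives of \<open>g\<close> are invariant under all permutations of their three indices; the
  two transpositions below generate them.
\<close>

lemma hessian_derivative_symmetric:
  assumes "smooth g"
  shows "hessian_derivative g x (axis k 1) $ i $ j = hessian_derivative g x (axis i 1) $ k $ j"
    and "hessian_derivative g x h $ i $ j = hessian_derivative g x h $ j $ i"
proof -
  have "hessian g y $ j $ i = hessian g y $ i $ j" for y i j
    using arg_cong[OF symmetric_hessian[OF assms, of y], of "\<lambda>M. M $ i $ j"]
    by (simp add: transpose_def)
  then have sym: "(\<lambda>y. hessian g y $ i $ j) = (\<lambda>y. hessian g y $ j $ i)" for i j
    by (intro ext)
  show "hessian_derivative g x h $ i $ j = hessian_derivative g x h $ j $ i"
    unfolding hessian_derivative_nth[OF assms] by (subst sym) (rule refl)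
  have swap: "(\<lambda>y. hessian g y $ l $ j) =
      (\<lambda>y. frechet_derivative (\<lambda>z. frechet_derivative g (at z) (axis j 1)) (at y) (axis l 1))" for l
    by (subst sym) (simp only: hessian_nth[OF assms])
  show "hessian_derivative g x (axis k 1) $ i $ j = hessian_derivative g x (axis i 1) $ k $ j"
    unfolding hessian_derivative_nth[OF assms] swap
    by (rule second_derivative_symmetric[OF smooth_frechet_derivative[OF assms]])
qed

section \<open>Derivatives of the determinant and of the inverse matrix\<close>

lemma matrix_inv_right_left:
  fixes A :: "real^'n^'n"
  assumes "det A \<noteq> 0"
  shows "A ** matrix_inv A = mat 1" "matrix_inv A ** A = mat 1"
proof -
  have "\<exists>A'. A ** A' = mat 1 \<and> A' ** A = mat 1"
    using assms by (simp add: invertible_det_nz[symmetric] invertible_def)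
  then have "A ** matrix_inv A = mat 1 \<and> matrix_inv A ** A = mat 1"
    unfolding matrix_inv_def by (rule someI_ex)
  then show "A ** matrix_inv A = mat 1" "matrix_inv A ** A = mat 1"
    by auto
qed

text \<open>
  Row \<open>k\<close> of \<open>H = (H A\<^sup>-\<^sup>1) A\<close> is a combination of the rows of \<open>A\<close>, and in the determinant only
  the multiple of row \<open>k\<close> itself survives. Summed over \<open>k\<close>, this is the trace in Jacobi's
  formula.
\<close>

lemma det_replace_row:
  fixes A H :: "real^'n^'n"
  assumes "det A \<noteq> 0"
  shows "det (\<chi> i. if i = k then row k H else row i A) = (H ** matrix_inv A) $ k $ k * det A"
proof -
  let ?x = "row k (H ** matrix_inv A)"
  have "row k H = row k ((H ** matrix_inv A) ** A)"
    by (simp add: matrix_mul_assoc[symmetric] matrix_inv_right_left[OF assms])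
  also have "\<dots> = (\<Sum>i\<in>UNIV. ?x $ i *s row i A)"
    by (simp add: vec_eq_iff row_def matrix_matrix_mult_def)
  finally have "det (\<chi> i. if i = k then row k H else row i A) =
      det (\<chi> i. if i = k then (\<Sum>i\<in>UNIV. ?x $ i *s row i A) else row i A)"
    by (rule arg_cong[where f = "\<lambda>v. det (\<chi> i. if i = k then v else row i A)"])
  also have "\<dots> = ?x $ k * det A"
    by (rule cramer_lemma_transpose)
  finally show ?thesis
    by (simp add: row_def)
qed

text \<open>
  Jacobi's formula. The product rule applied to the Leibniz expansion gives the sum of the
  determinants in which one row of \<open>A\<close> is replaced by its derivative.
\<close>

lemma has_derivative_det:
  fixes A :: "'a::real_normed_vector \<Rightarrow> real^'n^'n"
  assumes A: "(A has_derivative A') (at x within S)" and nz: "det (A x) \<noteq> 0"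
  shows "((\<lambda>y. det (A y)) has_derivative
    (\<lambda>h. det (A x) * trace (A' h ** matrix_inv (A x)))) (at x within S)"
proof -
  have entry: "((\<lambda>y. A y $ i $ j) has_derivative (\<lambda>h. A' h $ i $ j)) (at x within S)" for i j
    by (intro bounded_linear.has_derivative[OF bounded_linear_vec_nth] A)
  let ?P = "{p. p permutes (UNIV :: 'n set)}"
  have "((\<lambda>y. det (A y)) has_derivative (\<lambda>h. \<Sum>p\<in>?P. of_int (sign p) *
      (\<Sum>k\<in>UNIV. A' h $ k $ p k * (\<Prod>i\<in>UNIV - {k}. A x $ i $ p i)))) (at x within S)"
    unfolding det_def by (intro has_derivative_sum has_derivative_mult_right has_derivative_prod entry)
  moreover have "(\<Sum>p\<in>?P. of_int (sign p) *
      (\<Sum>k\<in>UNIV. A' h $ k $ p k * (\<Prod>i\<in>UNIV - {k}. A x $ i $ p i))) =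
      det (A x) * trace (A' h ** matrix_inv (A x))" for h
  proof -
    have "A' h $ k $ p k * (\<Prod>i\<in>UNIV - {k}. A x $ i $ p i) =
        (\<Prod>i\<in>UNIV. (\<chi> i. if i = k then row k (A' h) else row i (A x)) $ i $ p i)" for k and p :: "'n \<Rightarrow> 'n"
      by (subst prod.remove[of UNIV k]) (auto simp: row_def intro!: prod.cong)
    then have "(\<Sum>p\<in>?P. of_int (sign p) *
      (\<Sum>k\<in>UNIV. A' h $ k $ p k * (\<Prod>i\<in>UNIV - {k}. A x $ i $ p i))) =
      (\<Sum>k\<in>UNIV. det (\<chi> i. if i = k then row k (A' h) else row i (A x)))"
      unfolding det_def sum_distrib_left by (subst sum.swap) simp
    then show ?thesis
      by (simp add: det_replace_row[OF nz] trace_def sum_distrib_left mult.commute)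
  qed
  ultimately show ?thesis
    by simp
qed

lemma bounded_bilinear_matrix_matrix_mult:
  "bounded_bilinear ((**) :: real^'n^'m \<Rightarrow> real^'k^'n \<Rightarrow> real^'k^'m)"
proof -
  have "bilinear ((**) :: real^'n^'m \<Rightarrow> real^'k^'n \<Rightarrow> real^'k^'m)"
    unfolding bilinear_def
    by (auto intro!: linearI simp: vec_eq_iff matrix_matrix_mult_def sum.distrib sum_distrib_left
        algebra_simps)
  then show ?thesis
    by (simp add: bilinear_conv_bounded_bilinear)
qed

text \<open>
  Cramer's rule exhibits the entries of the inverse as quotients of determinants, which is
  how their differentiability is obtained.
\<close>

lemma matrix_inv_nth:
  fixes A :: "real^'n^'n"
  assumes "det A \<noteq> 0"
  shows "matrix_inv A $ k $ j =
    det (\<chi> i l. if l = k then axis j 1 $ i else A $ i $ l) / det A"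
proof -
  have "A *v (matrix_inv A *v axis j 1) = axis j 1"
    by (simp add: matrix_vector_mul_assoc matrix_inv_right_left[OF assms])
  then have "matrix_inv A *v axis j 1 =
      (\<chi> k. det (\<chi> i l. if l = k then axis j 1 $ i else A $ i $ l) / det A)"
    by (simp add: cramer[OF assms])
  then have "(matrix_inv A *v axis j 1) $ k =
      det (\<chi> i l. if l = k then axis j 1 $ i else A $ i $ l) / det A"
    by simp
  then show ?thesis
    by (simp add: matrix_vector_mult_basis column_def)
qed

lemma differentiable_det:
  fixes A :: "'a::real_normed_vector \<Rightarrow> real^'n^'n"
  assumes "\<And>i j. (\<lambda>y. A y $ i $ j) differentiable (at x within S)"
  shows "(\<lambda>y. det (A y)) differentiable (at x within S)"
proof -
  obtain D where D: "\<And>i j. ((\<lambda>y. A y $ i $ j) has_derivative D i j) (at x within S)"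
    using assms unfolding differentiable_def by metis
  have "(\<lambda>y. \<Prod>i\<in>I. A y $ i $ p i) differentiable (at x within S)" for I and p :: "'n \<Rightarrow> 'n"
    using has_derivative_prod[of I "\<lambda>i y. A y $ i $ p i" "\<lambda>i. D i (p i)" x S] D
    unfolding differentiable_def by blast
  then show ?thesis
    unfolding det_def by (intro differentiable_sum differentiable_mult) auto
qed

text \<open>
  Once the inverse \<open>B\<close> is known to be differentiable, its derivative is forced by
  differentiating \<open>B A = I\<close>, which holds in a neighbourhood of the point.
\<close>

lemma has_derivative_matrix_inv:
  fixes A :: "'a::real_normed_vector \<Rightarrow> real^'n^'n"
  assumes A: "(A has_derivative A') (at x)" and nz: "det (A x) \<noteq> 0"
  shows "((\<lambda>y. matrix_inv (A y)) has_derivative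
    (\<lambda>h. - (matrix_inv (A x) ** A' h ** matrix_inv (A x)))) (at x)"
proof -
  let ?B = "\<lambda>y. matrix_inv (A y)"
  have dA: "(\<lambda>y. A y $ i $ j) differentiable (at x)" for i j
    using bounded_linear.has_derivative[OF bounded_linear_vec_nth
        bounded_linear.has_derivative[OF bounded_linear_vec_nth A]] differentiable_def by blast
  have ddet: "(\<lambda>y. det (A y)) differentiable (at x)"
    by (intro differentiable_det dA)
  have "isCont (\<lambda>y. det (A y)) x"
    by (rule differentiable_imp_continuous_within[OF ddet])
  then have "\<forall>\<^sub>F y in nhds x. det (A y) \<noteq> 0"
    using nz by (auto simp: continuous_at eventually_nhds_conv_at intro: tendsto_imp_eventually_ne)
  then obtain U where U: "open U" "x \<in> U" "\<And>y. y \<in> U \<Longrightarrow> det (A y) \<noteq> 0"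
    unfolding eventually_nhds by blast
  have "(\<lambda>y. ?B y $ k $ j) differentiable (at x)" for k j
  proof -
    have "(\<lambda>y. (\<chi> i l. if l = k then axis j 1 $ i else A y $ i $ l) $ i $ l) differentiable (at x)" for i l
      using dA[of i l] by (cases "l = k") auto
    then have "(\<lambda>y. det (\<chi> i l. if l = k then axis j 1 $ i else A y $ i $ l) / det (A y))
        differentiable (at x)"
      by (intro differentiable_divide differentiable_det ddet nz)
    then obtain D where "((\<lambda>y. det (\<chi> i l. if l = k then axis j 1 $ i else A y $ i $ l) / det (A y))
        has_derivative D) (at x)"
      unfolding differentiable_def by blast
    then have "((\<lambda>y. ?B y $ k $ j) has_derivative D) (at x)"
      by (rule has_derivative_transform_within_open[OF _ U(1,2)]) (simp add: matrix_inv_nth U(3))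
    then show ?thesis
      unfolding differentiable_def by blast
  qed
  then have "?B differentiable (at x)"
    unfolding differentiable_componentwise_within[where f = ?B]
    by (auto simp: Basis_vec_def inner_axis)
  then obtain B' where B': "(?B has_derivative B') (at x)"
    unfolding differentiable_def by blast
  have "((\<lambda>y. ?B y ** A y) has_derivative (\<lambda>h. ?B x ** A' h + B' h ** A x)) (at x)"
    by (rule bounded_bilinear.FDERIV[OF bounded_bilinear_matrix_matrix_mult B' A])
  moreover have "((\<lambda>y. ?B y ** A y) has_derivative (\<lambda>h. 0)) (at x)"
    by (rule has_derivative_transform_within_open[OF has_derivative_const[of "mat 1"] U(1,2)])
      (simp add: matrix_inv_right_left U(3))
  ultimately have "(\<lambda>h. ?B x ** A' h + B' h ** A x) = (\<lambda>h. 0)"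
    by (rule has_derivative_unique)
  then have "?B x ** A' h + B' h ** A x = 0" for h
    by (rule fun_cong)
  then have *: "B' h ** A x = - (?B x ** A' h)" for h
    by (simp add: eq_neg_iff_add_eq_0 add.commute)
  have "B' h = - (?B x ** A' h ** ?B x)" for h
  proof -
    have "B' h = (B' h ** A x) ** ?B x"
      by (simp add: matrix_mul_assoc[symmetric] matrix_inv_right_left[OF nz])
    also have "\<dots> = - (?B x ** A' h ** ?B x)"
      unfolding * using bounded_bilinear.minus_left[OF bounded_bilinear_matrix_matrix_mult] by blast
    finally show ?thesis .
  qed
  then have "B' = (\<lambda>h. - (?B x ** A' h ** ?B x))"
    by blast
  with B' show ?thesis
    by simp
qed

lemma transpose_matrix_inv:
  fixes A :: "real^'n^'n"
  assumes "det A \<noteq> 0" "transpose A = A"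
  shows "transpose (matrix_inv A) = matrix_inv A"
proof -
  have "transpose (matrix_inv A) ** A = mat 1"
    using arg_cong[OF matrix_inv_right_left(1)[OF assms(1)], of transpose]
    by (simp add: matrix_transpose_mul assms transpose_mat)
  then have "transpose (matrix_inv A) ** (A ** matrix_inv A) = matrix_inv A"
    by (simp add: matrix_mul_assoc)
  then show ?thesis
    by (simp add: matrix_inv_right_left[OF assms(1)])
qed

section \<open>Injectivity of the gradient of a convex function\<close>

text \<open>
  By convexity the difference quotients of \<open>u\<close> at \<open>x\<close> in the direction of \<open>y\<close> are bounded above by
  \<open>u y - u x\<close>, and at a critical point they tend to 0.
\<close>

lemma convex_critical_point_minimum:
  fixes u :: "'a::real_normed_vector \<Rightarrow> real"
  assumes u: "convex_on UNIV u" and d: "(u has_derivative (\<lambda>h. 0)) (at x)"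
  shows "u x \<le> u y"
proof -
  let ?q = "\<lambda>t. u (x + t *\<^sub>R (y - x))"
  have "((\<lambda>t. x + t *\<^sub>R (y - x)) has_derivative (\<lambda>k. k *\<^sub>R (y - x))) (at 0)"
    by (auto intro!: derivative_eq_intros)
  moreover have "(u has_derivative (\<lambda>h. 0)) (at (x + 0 *\<^sub>R (y - x)))"
    using d by simp
  ultimately have "(?q has_derivative (\<lambda>k. 0)) (at 0)"
    using diff_chain_at[of "\<lambda>t. x + t *\<^sub>R (y - x)" _ 0 u "\<lambda>h. 0"] by (simp add: o_def)
  then have "(?q has_real_derivative 0) (at 0)"
    by (rule has_derivative_imp_has_field_derivative) simp
  then have "((\<lambda>t. (?q t - u x) / t) \<longlongrightarrow> 0) (at 0)"
    by (simp add: has_field_derivative_iff)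
  then have "((\<lambda>t. (?q t - u x) / t) \<longlongrightarrow> 0) (at_right 0)"
    by (rule filterlim_mono) (auto simp: at_le)
  moreover have "\<forall>\<^sub>F t in at_right 0. (?q t - u x) / t \<le> u y - u x"
  proof -
    have "\<forall>\<^sub>F t in at_right (0::real). t \<in> {0<..<1}"
      by (rule eventually_at_right_real) simp
    then show ?thesis
    proof (rule eventually_mono)
      fix t :: real
      assume t: "t \<in> {0<..<1}"
      have "?q t = u ((1 - t) *\<^sub>R x + t *\<^sub>R y)"
        by (simp add: algebra_simps)
      also have "\<dots> \<le> (1 - t) * u x + t * u y"
        using convex_onD[OF u, of t x y] t by simp
      finally show "(?q t - u x) / t \<le> u y - u x"
        using t by (simp add: field_simps)
    qed
  qed
  ultimately have "0 \<le> u y - u x"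
    using tendsto_upperbound trivial_limit_at_right_real by blast
  then show ?thesis
    by simp
qed

text \<open>
  Subtracting the linear function with gradient \<open>G x\<close> makes \<open>x\<close> and \<open>y\<close> critical, hence minimum
  points of a convex function. Then the whole segment consists of minimum points, where the
  gradient vanishes.
\<close>

lemma convex_gradient_fibre_convex:
  fixes u :: "'a::real_inner \<Rightarrow> real"
  assumes u: "convex_on UNIV u" and d: "\<And>z. (u has_derivative (\<lambda>h. inner (G z) h)) (at z)"
    and xy: "G x = G y" and t: "0 \<le> t" "t \<le> 1"
  shows "G (x + t *\<^sub>R (y - x)) = G x"
proof -
  let ?v = "\<lambda>w. u w - inner (G x) w"
  have "linear (\<lambda>w. - inner (G x) w)"
    by (intro linearI) (auto simp: inner_add_right)
  then have "convex_on UNIV (\<lambda>w. - inner (G x) w)"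
    by (auto intro!: convex_onI simp: inner_add_right algebra_simps)
  from convex_on_add[OF u this] have v: "convex_on UNIV ?v"
    by simp
  have dv: "(?v has_derivative (\<lambda>h. inner (G z - G x) h)) (at z)" for z
    by (auto intro!: derivative_eq_intros d simp: inner_diff_left)
  have min: "?v z \<le> ?v w" if "G z = G x" for z w
    using convex_critical_point_minimum[OF v, of z w] dv[of z] that by simp
  let ?z = "x + t *\<^sub>R (y - x)"
  have "?v ?z \<le> ?v w" for w
  proof -
    have "?v ?z = ?v ((1 - t) *\<^sub>R x + t *\<^sub>R y)"
      by (simp add: algebra_simps)
    also have "\<dots> \<le> (1 - t) * ?v x + t * ?v y"
      using convex_onD[OF v, of t x y] t by simp
    also have "\<dots> \<le> (1 - t) * ?v w + t * ?v w"
      using t min[of x w] min[of y w] xy by (intro add_mono mult_left_mono) auto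
    finally show ?thesis
      by (simp add: algebra_simps)
  qed
  then have "(\<lambda>h. inner (G ?z - G x) h) = (\<lambda>h. 0)"
    by (intro differential_zero_maxmin[OF _ open_UNIV dv]) auto
  then have "inner (G ?z - G x) (G ?z - G x) = 0"
    by (rule fun_cong)
  then show ?thesis
    by simp
qed

text \<open>
  If \<open>y\<close> were a second point of the fibre, \<open>G\<close> would be constant on the segment from \<open>x\<close> to \<open>y\<close>, so
  that its one-sided derivative \<open>A (y - x)\<close> at \<open>x\<close> would vanish.
\<close>

lemma convex_gradient_injective_at_regular_point:
  fixes u :: "real^'n \<Rightarrow> real" and G :: "real^'n \<Rightarrow> real^'n"
  assumes u: "convex_on UNIV u" and d: "\<And>z. (u has_derivative (\<lambda>h. inner (G z) h)) (at z)"
    and G: "(G has_derivative (\<lambda>h. A *v h)) (at x)" and nz: "det A \<noteq> 0" and xy: "G x = G y"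
  shows "y = x"
proof -
  let ?l = "\<lambda>t. x + t *\<^sub>R (y - x)"
  have "(?l has_derivative (\<lambda>k. k *\<^sub>R (y - x))) (at 0 within {0..1})"
    by (auto intro!: derivative_eq_intros)
  moreover have "(G has_derivative (\<lambda>h. A *v h)) (at (?l 0) within ?l ` {0..1})"
    using G by (simp add: has_derivative_at_withinI)
  ultimately have "((\<lambda>t. G (?l t)) has_derivative (\<lambda>k. A *v (k *\<^sub>R (y - x)))) (at 0 within {0..1})"
    using diff_chain_within[of ?l _ 0 "{0..1}" G] by (simp add: o_def)
  moreover have "((\<lambda>t. G (?l t)) has_derivative (\<lambda>k. 0)) (at 0 within {0..1})"
    by (rule has_derivative_transform[OF _ _ has_derivative_const[of "G x"]])
      (auto simp: convex_gradient_fibre_convex[OF u d xy])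
  ultimately have "((\<lambda>t. G (?l t)) has_vector_derivative A *v (y - x)) (at 0 within {0..1})"
    "((\<lambda>t. G (?l t)) has_vector_derivative 0) (at 0 within {0..1})"
    by (auto simp: has_vector_derivative_def scaleR_matrix_vector_assoc matrix_vector_mult_scaleR)
  then have "A *v (y - x) = 0"
    by (intro vector_derivative_unique_within) (auto simp: trivial_limit_within)
  moreover have "inj ((*v) A)"
    using nz by (simp add: invertible_det_nz[symmetric] inj_matrix_vector_mult)
  ultimately have "y - x = 0"
    by (metis injD matrix_vector_mult_0_right)
  then show ?thesis
    by simp
qed

section \<open>Change of variables and Sard's theorem for unordered coordinates\<close>

text \<open>
  Neither the change of variables formula nor Sard's theorem depends on an order of the coordinates,
  but \<open>integral_change_of_variables\<close> and \<open>baby_Sard\<close> are stated for a well-ordered index type. A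
  copy of an arbitrary finite index type, ordered by an enumeration, carries both over: the
  relabelling of coordinates preserves Lebesgue measure and Jacobian determinants.
\<close>

typedef 'n ordered_index = "UNIV :: 'n set"
  by simp

instance ordered_index :: (finite) finite
proof
  have "range (Abs_ordered_index :: 'a \<Rightarrow> 'a ordered_index) = UNIV"
    using type_definition.Abs_image[OF type_definition_ordered_index] .
  then show "finite (UNIV :: 'a ordered_index set)"
    by (metis finite_class.finite_UNIV finite_imageI)
qed

instantiation ordered_index :: (finite) wellorder
begin

definition less_eq_ordered_index :: "'a ordered_index \<Rightarrow> 'a ordered_index \<Rightarrow> bool" where
  "i \<le> j \<longleftrightarrow> to_nat_on (UNIV :: 'a set) (Rep_ordered_index i) \<le> to_nat_on UNIV (Rep_ordered_index j)"

definition less_ordered_index :: "'a ordered_index \<Rightarrow> 'a ordered_index \<Rightarrow> bool" where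
  "i < j \<longleftrightarrow> to_nat_on (UNIV :: 'a set) (Rep_ordered_index i) < to_nat_on UNIV (Rep_ordered_index j)"

instance
proof
  have inj: "to_nat_on (UNIV :: 'a set) (Rep_ordered_index i) = to_nat_on UNIV (Rep_ordered_index j) \<longleftrightarrow> i = j"
    for i j :: "'a ordered_index"
    using inj_on_to_nat_on[OF countable_finite[OF finite_class.finite_UNIV]]
    by (auto simp: inj_def Rep_ordered_index_inject)
  fix i j k :: "'a ordered_index"
  show "i < j \<longleftrightarrow> i \<le> j \<and> \<not> j \<le> i" "i \<le> i" "i \<le> j \<or> j \<le> i"
    by (auto simp: less_eq_ordered_index_def less_ordered_index_def)
  show "i \<le> k" if "i \<le> j" "j \<le> k"
    using that by (auto simp: less_eq_ordered_index_def)
  show "i = j" if "i \<le> j" "j \<le> i"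
    using that by (simp add: less_eq_ordered_index_def inj[symmetric])
next
  fix P and a :: "'a ordered_index"
  assume step: "\<And>x :: 'a ordered_index. (\<And>y. y < x \<Longrightarrow> P y) \<Longrightarrow> P x"
  show "P a"
  proof (induction a rule: measure_induct_rule[where f = "\<lambda>i. to_nat_on UNIV (Rep_ordered_index i)"])
    case (less x)
    show ?case
    proof (rule step)
      show "P y" if "y < x" for y
        using that by (intro less) (simp add: less_ordered_index_def)
    qed
  qed
qed

end

lemma card_ordered_index: "CARD('n ordered_index) = CARD('n)"
  using type_definition.card[OF type_definition_ordered_index] by simp

lemma bij_Rep_ordered_index: "bij Rep_ordered_index"
  using type_definition.Rep_range[OF type_definition_ordered_index]
  by (auto simp: bij_def inj_def Rep_ordered_index_inject)

lemma swapidseq_conjugate: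
  assumes "swapidseq n p" and r: "bij r"
  shows "swapidseq n (inv r \<circ> p \<circ> r)"
  using assms(1)
proof induction
  case id
  have "inv r \<circ> id \<circ> r = id"
    using r by (simp add: fun_eq_iff bij_is_inj)
  then show ?case
    by (simp only: swapidseq.id)
next
  case (comp_Suc n p a b)
  have "inv r \<circ> (Transposition.transpose a b \<circ> p) \<circ> r =
      Transposition.transpose (inv r a) (inv r b) \<circ> (inv r \<circ> p \<circ> r)"
    using r by (auto simp: fun_eq_iff Transposition.transpose_def bij_inv_eq_iff bij_is_surj surj_f_inv_f)
  moreover have "inv r a \<noteq> inv r b"
    using comp_Suc r by (metis bij_inv_eq_iff)
  ultimately show ?case
    using swapidseq.comp_Suc[OF comp_Suc.IH] by metis
qed

lemma sign_conjugate:
  assumes "permutation p" and r: "bij r"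
  shows "sign (inv r \<circ> p \<circ> r) = sign p"
proof -
  obtain n where n: "swapidseq n p"
    using assms by (auto simp: permutation_def)
  have "evenperm p = even n"
    using evenperm_unique[OF n] by simp
  moreover have "evenperm (inv r \<circ> p \<circ> r) = even n"
    using evenperm_unique[OF swapidseq_conjugate[OF n r]] by simp
  ultimately show ?thesis
    by (simp add: sign_def)
qed

text \<open>
  The Leibniz expansions correspond term by term when permutations are conjugated with \<open>r\<close>. As \<open>r\<close>
  may go between different types, invariance of the sign is not the homomorphism
  property of the sign, but comes from conjugating a decomposition into transpositions.
\<close>

lemma det_reindex:
  fixes A :: "real^'n^'n" and r :: "'m::finite \<Rightarrow> 'n"
  assumes r: "bij r"
  shows "det (\<chi> i j. A $ r i $ r j) = det A"
proof -
  have inv: "inv r (r i) = i" "r (inv r k) = k" for i k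
    using r by (auto simp: bij_is_inj bij_is_surj surj_f_inv_f)
  have bij: "p permutes UNIV \<longleftrightarrow> bij p" for p :: "'k \<Rightarrow> 'k"
    by (auto simp: permutes_bij intro: bij_imp_permutes)
  show ?thesis
    unfolding det_def
  proof (rule sum.reindex_bij_witness[where i = "\<lambda>p. inv r \<circ> p \<circ> r" and j = "\<lambda>p. r \<circ> p \<circ> inv r"])
    fix p :: "'m \<Rightarrow> 'm"
    assume p: "p \<in> {p. p permutes UNIV}"
    let ?q = "r \<circ> p \<circ> inv r"
    show "inv r \<circ> ?q \<circ> r = p"
      by (simp add: fun_eq_iff inv)
    have "bij ?q"
      using p r by (simp add: bij bij_comp bij_imp_bij_inv)
    then show q: "?q \<in> {p. p permutes UNIV}"
      by (simp add: bij)
    have "permutation ?q"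
      using q by (metis finite mem_Collect_eq permutation_permutes)
    then have "sign p = sign ?q"
      using sign_conjugate[OF _ r, of ?q] \<open>inv r \<circ> ?q \<circ> r = p\<close> by simp
    moreover have "(\<Prod>k\<in>UNIV. A $ k $ ?q k) = (\<Prod>i\<in>UNIV. A $ r i $ ?q (r i))"
      using prod.reindex_bij_betw[OF r, of "\<lambda>k. A $ k $ ?q k"] by simp
    ultimately show "of_int (sign ?q) * (\<Prod>k\<in>UNIV. A $ k $ ?q k) =
        of_int (sign p) * (\<Prod>i\<in>UNIV. (\<chi> i j. A $ r i $ r j) $ i $ p i)"
      by (simp add: inv)
  next
    fix q :: "'n \<Rightarrow> 'n"
    assume q: "q \<in> {p. p permutes UNIV}"
    show "r \<circ> (inv r \<circ> q \<circ> r) \<circ> inv r = q"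
      by (simp add: fun_eq_iff inv)
    have "bij (inv r \<circ> q \<circ> r)"
      using q r by (simp add: bij bij_comp bij_imp_bij_inv)
    then show "inv r \<circ> q \<circ> r \<in> {p. p permutes UNIV}"
      by (simp add: bij)
  qed
qed

definition reindex_vec :: "('m::finite \<Rightarrow> 'n::finite) \<Rightarrow> real^'n \<Rightarrow> real^'m" where
  "reindex_vec r x = (\<chi> i. x $ r i)"

lemma linear_reindex_vec: "linear (reindex_vec r)"
  by (auto intro!: linearI simp: reindex_vec_def vec_eq_iff)

lemma reindex_vec_inv:
  assumes "bij r"
  shows "reindex_vec r (reindex_vec (inv r) y) = y" "reindex_vec (inv r) (reindex_vec r x) = x"
  using assms by (auto simp: reindex_vec_def vec_eq_iff bij_is_inj bij_is_surj surj_f_inv_f)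

lemma matrix_reindex:
  fixes L :: "real^'n \<Rightarrow> real^'n" and r :: "'m::finite \<Rightarrow> 'n"
  assumes r: "bij r"
  shows "matrix (\<lambda>y. reindex_vec r (L (reindex_vec (inv r) y))) = (\<chi> i j. matrix L $ r i $ r j)"
proof -
  have "inv r k = j \<longleftrightarrow> k = r j" for k j
    using bij_inv_eq_iff[OF r, of j k] by auto
  then have "reindex_vec (inv r) (axis j 1) = axis (r j) 1" for j
    by (simp add: reindex_vec_def vec_eq_iff axis_def)
  then show ?thesis
    by (simp add: matrix_def vec_eq_iff) (simp add: reindex_vec_def)
qed

lemma emeasure_lborel_box_cart:
  fixes l u :: "real^'n"
  assumes "\<And>i. l $ i \<le> u $ i"
  shows "emeasure lborel (box l u) = ennreal (\<Prod>i\<in>UNIV. u $ i - l $ i)"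
proof -
  have "inj (\<lambda>i::'n. axis i (1::real))"
    by (auto simp: inj_def axis_eq_axis)
  then have "(\<Prod>b\<in>Basis. (u - l) \<bullet> b) = (\<Prod>i\<in>UNIV. u $ i - l $ i)"
    by (simp add: Basis_vec_def UNION_singleton_eq_range prod.reindex inner_axis)
  moreover have "emeasure lborel (box l u) = ennreal (\<Prod>b\<in>Basis. (u - l) \<bullet> b)"
    using assms by (subst emeasure_lborel_box) (auto simp: Basis_vec_def inner_axis)
  ultimately show ?thesis
    by simp
qed

text \<open>
  The preimage of a box under a permutation of coordinates is the box with permuted sides, and
  Lebesgue measure is determined by its values on boxes.
\<close>

lemma distr_lborel_reindex_vec:
  fixes r :: "'m::finite \<Rightarrow> 'n::finite"
  assumes r: "bij r"
  shows "distr lborel borel (reindex_vec r) = (lborel :: (real^'m) measure)"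
proof (rule lborel_eqI[symmetric])
  fix l u :: "real^'m"
  assume le: "\<And>b. b \<in> Basis \<Longrightarrow> l \<bullet> b \<le> u \<bullet> b"
  have lu: "l $ i \<le> u $ i" for i
    using le[of "axis i 1"] by (simp add: cart_eq_inner_axis axis_in_Basis_iff Basis_real_def)
  let ?Q = "reindex_vec (inv r) :: real^'m \<Rightarrow> real^'n"
  have [measurable]: "reindex_vec r \<in> borel_measurable borel"
    by (intro borel_measurable_continuous_onI linear_continuous_on)
      (simp add: linear_conv_bounded_linear[symmetric] linear_reindex_vec)
  have inv: "inv r (r i) = i" "r (inv r k) = k" for i k
    using r by (auto simp: bij_is_inj bij_is_surj surj_f_inv_f)
  have "reindex_vec r x \<in> box l u \<longleftrightarrow> x \<in> box (?Q l) (?Q u)" for x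
  proof
    assume "reindex_vec r x \<in> box l u"
    then have "l $ inv r k < x $ r (inv r k) \<and> x $ r (inv r k) < u $ inv r k" for k
      by (simp add: reindex_vec_def mem_box_cart)
    then show "x \<in> box (?Q l) (?Q u)"
      by (simp add: reindex_vec_def mem_box_cart inv)
  next
    assume "x \<in> box (?Q l) (?Q u)"
    then have "l $ inv r (r i) < x $ r i \<and> x $ r i < u $ inv r (r i)" for i
      by (simp add: reindex_vec_def mem_box_cart)
    then show "reindex_vec r x \<in> box l u"
      by (simp add: reindex_vec_def mem_box_cart inv)
  qed
  then have "reindex_vec r -` box l u = box (?Q l) (?Q u)"
    by blast
  then have "emeasure (distr lborel borel (reindex_vec r)) (box l u) = emeasure lborel (box (?Q l) (?Q u))"
    by (simp add: emeasure_distr)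
  also have "\<dots> = ennreal (\<Prod>k\<in>UNIV. u $ inv r k - l $ inv r k)"
    by (subst emeasure_lborel_box_cart) (auto simp: reindex_vec_def lu)
  also have "(\<Prod>k\<in>UNIV. u $ inv r k - l $ inv r k) = (\<Prod>i\<in>UNIV. u $ i - l $ i)"
    using prod.reindex_bij_betw[OF bij_imp_bij_inv[OF r], of "\<lambda>i. u $ i - l $ i"] by simp
  also have "ennreal \<dots> = emeasure lborel (box l u)"
    by (simp add: emeasure_lborel_box_cart lu)
  also have "\<dots> = (\<Prod>b\<in>Basis. (u - l) \<bullet> b)"
    using le by (rule emeasure_lborel_box)
  finally show "emeasure (distr lborel borel (reindex_vec r)) (box l u) = (\<Prod>b\<in>Basis. (u - l) \<bullet> b)" .
qed simp

text \<open>
  For continuous functions on compact sets the gauge integral is a Borel integral, which can be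
  transported through image measures.
\<close>

lemma integral_compact_eq_lborel:
  fixes f :: "'a::euclidean_space \<Rightarrow> real"
  assumes S: "compact S" and f: "continuous_on S f"
  shows "f absolutely_integrable_on S" "integral S f = (\<integral>x. indicator S x * f x \<partial>lborel)"
proof -
  have i: "set_integrable lborel S f"
    using borel_integrable_compact[OF S f]
    by (simp add: set_integrable_def indicator_scaleR_eq_if)
  then show "integral S f = (\<integral>x. indicator S x * f x \<partial>lborel)"
    using set_borel_integral_eq_integral(2)[OF i] by (simp add: set_lebesgue_integral_def)
  show "f absolutely_integrable_on S"
    using i by (simp add: set_integrable_def integrable_completion)
qed

lemma continuous_on_reindex_vec: "continuous_on X (reindex_vec r)"
  by (intro linear_continuous_on) (simp add: linear_conv_bounded_linear[symmetric] linear_reindex_vec)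

lemma integral_reindex_vec:
  fixes f :: "real^'n \<Rightarrow> real" and r :: "'m::finite \<Rightarrow> 'n"
  assumes r: "bij r" and S: "compact S" and f: "continuous_on S f"
  shows "integral (reindex_vec r ` S) (\<lambda>y. f (reindex_vec (inv r) y)) = integral S f"
proof -
  let ?P = "reindex_vec r" and ?Q = "reindex_vec (inv r)"
  note cont = continuous_on_reindex_vec
  have PQ: "?P (?Q y) = y" "?Q (?P x) = x" for x y
    using reindex_vec_inv[OF r] by auto
  have S': "compact (?P ` S)"
    by (intro compact_continuous_image cont S)
  have QP: "?Q ` ?P ` S = S"
    by (simp add: image_image PQ)
  have f': "continuous_on (?P ` S) (\<lambda>y. f (?Q y))"
    by (rule continuous_on_compose2[OF f cont]) (simp add: QP)
  have [measurable]: "?P \<in> borel_measurable borel"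
    by (intro borel_measurable_continuous_onI cont)
  have [measurable]: "(\<lambda>y. indicator (?P ` S) y * f (?Q y)) \<in> borel_measurable borel"
    using borel_measurable_continuous_on_indicator[OF borel_compact[OF S'] f'] by simp
  have "integral (?P ` S) (\<lambda>y. f (?Q y)) = (\<integral>y. indicator (?P ` S) y * f (?Q y) \<partial>lborel)"
    by (rule integral_compact_eq_lborel[OF S' f'])
  also have "\<dots> = (\<integral>y. indicator (?P ` S) y * f (?Q y) \<partial>distr lborel borel ?P)"
    by (simp only: distr_lborel_reindex_vec[OF r])
  also have "\<dots> = (\<integral>x. indicator (?P ` S) (?P x) * f (?Q (?P x)) \<partial>lborel)"
    by (rule integral_distr) simp_all
  also have "\<dots> = (\<integral>x. indicator S x * f x \<partial>lborel)"
  proof (rule Bochner_Integration.integral_cong[OF refl])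
    fix x
    have "?P x \<in> ?P ` S \<longleftrightarrow> x \<in> S"
      by (rule inj_image_mem_iff[OF inj_on_inverseI]) (rule PQ)
    then show "indicator (?P ` S) (?P x) * f (?Q (?P x)) = indicator S x * f x"
      by (simp add: PQ indicator_def)
  qed
  also have "\<dots> = integral S f"
    by (rule integral_compact_eq_lborel(2)[OF S f, symmetric])
  finally show ?thesis .
qed


lemma Jacobian_integral_compact:
  fixes g :: "real^'n \<Rightarrow> real^'n" and f :: "real^'n \<Rightarrow> real"
  assumes S: "compact S"
    and g: "\<And>x. x \<in> S \<Longrightarrow> (g has_derivative g' x) (at x within S)"
    and cont_det: "continuous_on S (\<lambda>x. det (matrix (g' x)))"
    and inj: "inj_on g S"
    and f: "continuous_on (g ` S) f"
  shows "integral (g ` S) f = integral S (\<lambda>x. \<bar>det (matrix (g' x))\<bar> * f (g x))"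
proof -
  define r where "r = (Rep_ordered_index :: 'n ordered_index \<Rightarrow> 'n)"
  have r: "bij r"
    by (simp add: r_def bij_Rep_ordered_index)
  let ?P = "reindex_vec r" and ?Q = "reindex_vec (inv r)"
  let ?g = "\<lambda>y. ?P (g (?Q y))" and ?g' = "\<lambda>y h. ?P (g' (?Q y) (?Q h))"
  have PQ: "?P (?Q y) = y" "?Q (?P x) = x" for x y
    using reindex_vec_inv[OF r] by auto
  have QP: "?Q ` ?P ` X = X" for X
    by (simp add: image_image PQ)
  have cont_g: "continuous_on S g"
    using g by (meson continuous_on_eq_continuous_within has_derivative_continuous)
  have gS: "compact (g ` S)"
    by (intro compact_continuous_image cont_g S)
  have S': "compact (?P ` S)"
    by (intro compact_continuous_image continuous_on_reindex_vec S)
  have img: "?g ` ?P ` S = ?P ` g ` S"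
    by (simp add: image_image PQ)
  have d: "(?g has_derivative ?g' y) (at y within ?P ` S)" if y: "y \<in> ?P ` S" for y
  proof -
    have "?Q y \<in> S"
      using y by (auto simp: PQ)
    then have "(g has_derivative g' (?Q y)) (at (?Q y) within ?Q ` ?P ` S)"
      by (simp add: QP g)
    then have "((\<lambda>y. g (?Q y)) has_derivative (\<lambda>h. g' (?Q y) (?Q h))) (at y within ?P ` S)"
      using diff_chain_within[OF linear_imp_has_derivative[OF linear_reindex_vec]]
      by (simp add: o_def)
    then show ?thesis
      using diff_chain_within[OF _ linear_imp_has_derivative[OF linear_reindex_vec]]
      by (simp add: o_def)
  qed
  have det: "det (matrix (?g' y)) = det (matrix (g' (?Q y)))" for y
    by (simp add: matrix_reindex[OF r] det_reindex[OF r])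
  have inj': "inj_on ?g (?P ` S)"
  proof -
    have "?P a = ?P b \<longleftrightarrow> a = b" for a b
      by (metis PQ(2))
    then show ?thesis
      using inj by (auto simp: inj_on_def PQ)
  qed
  let ?F = "\<lambda>y. f (?Q y)"
  have F: "continuous_on (?g ` ?P ` S) ?F"
    unfolding img by (rule continuous_on_compose2[OF f continuous_on_reindex_vec]) (simp add: QP)
  have F_abs: "(\<lambda>y. vec (?F y) :: real^1) absolutely_integrable_on ?g ` ?P ` S"
    unfolding absolutely_integrable_on_1_iff
    using integral_compact_eq_lborel(1)[OF _ F] gS
    by (simp add: img compact_continuous_image[OF continuous_on_reindex_vec])
  have "integral (?g ` ?P ` S) (\<lambda>y. vec (?F y) :: real^1) =
      integral (?P ` S) (\<lambda>y. \<bar>det (matrix (?g' y))\<bar> *\<^sub>R vec (?F (?g y)))"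
    by (rule integral_change_of_variables[OF lmeasurable_compact[OF S', THEN fmeasurableD] d inj'])
      (use F_abs in auto)
  then have "integral (?g ` ?P ` S) ?F = integral (?P ` S) (\<lambda>y. \<bar>det (matrix (?g' y))\<bar> * ?F (?g y))"
    by (simp add: integral_on_1_eq vec_eq_iff)
  also have "integral (?g ` ?P ` S) ?F = integral (g ` S) f"
    unfolding img by (rule integral_reindex_vec[OF r gS f])
  also have "(\<lambda>y. \<bar>det (matrix (?g' y))\<bar> * ?F (?g y)) =
      (\<lambda>y. (\<lambda>x. \<bar>det (matrix (g' x))\<bar> * f (g x)) (?Q y))"
    by (simp only: det PQ)
  also have "integral (?P ` S) \<dots> = integral S (\<lambda>x. \<bar>det (matrix (g' x))\<bar> * f (g x))"
    by (rule integral_reindex_vec[OF r S])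
      (intro continuous_intros cont_det continuous_on_compose2[OF f cont_g] subset_refl)
  finally show ?thesis .
qed

lemma Sard_critical_values_negligible:
  fixes g :: "real^'n \<Rightarrow> real^'n"
  assumes g: "\<And>x. x \<in> S \<Longrightarrow> (g has_derivative g' x) (at x within S)"
    and crit: "\<And>x. x \<in> S \<Longrightarrow> det (matrix (g' x)) = 0"
  shows "negligible (g ` S)"
proof -
  define r where "r = (Rep_ordered_index :: 'n ordered_index \<Rightarrow> 'n)"
  have r: "bij r"
    by (simp add: r_def bij_Rep_ordered_index)
  let ?P = "reindex_vec r" and ?Q = "reindex_vec (inv r)"
  let ?g = "\<lambda>y. ?P (g (?Q y))" and ?g' = "\<lambda>y h. ?P (g' (?Q y) (?Q h))"
  have PQ: "?P (?Q y) = y" "?Q (?P x) = x" for x y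
    using reindex_vec_inv[OF r] by auto
  have QP: "?Q ` ?P ` X = X" for X
    by (simp add: image_image PQ)
  have "negligible (?g ` ?P ` S)"
  proof (rule baby_Sard)
    fix y
    assume "y \<in> ?P ` S"
    then have y: "?Q y \<in> S"
      by (auto simp: PQ)
    then have "(g has_derivative g' (?Q y)) (at (?Q y) within ?Q ` ?P ` S)"
      by (simp add: QP g)
    then have "((\<lambda>y. g (?Q y)) has_derivative (\<lambda>h. g' (?Q y) (?Q h))) (at y within ?P ` S)"
      using diff_chain_within[OF linear_imp_has_derivative[OF linear_reindex_vec]]
      by (simp add: o_def)
    then show "(?g has_derivative ?g' y) (at y within ?P ` S)"
      using diff_chain_within[OF _ linear_imp_has_derivative[OF linear_reindex_vec]]
      by (simp add: o_def)
    have "det (matrix (?g' y)) = 0"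
      using crit[OF y] by (simp add: matrix_reindex[OF r] det_reindex[OF r])
    then show "rank (matrix (?g' y)) < CARD('n ordered_index)"
      by (simp add: det_eq_0_rank)
  qed simp
  then have "negligible (?P ` g ` S)"
    by (simp add: image_image PQ)
  then have "negligible (?Q ` ?P ` g ` S)"
    by (rule negligible_differentiable_image_negligible[rotated])
      (auto simp: card_ordered_index linear_imp_differentiable_on linear_reindex_vec)
  then show ?thesis
    by (simp add: QP)
qed

section \<open>The Monge--Ampere equation at regular points\<close>

lemma emeasure_density_lborel_compact:
  fixes p :: "'a::euclidean_space \<Rightarrow> real"
  assumes p: "continuous_on UNIV p" "\<And>x. 0 \<le> p x" and K: "compact K"
  shows "emeasure (density lborel (\<lambda>x. ennreal (p x))) K = ennreal (integral K p)"
proof -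
  have [measurable]: "p \<in> borel_measurable borel"
    using p by (intro borel_measurable_continuous_onI)
  have pK: "continuous_on K p"
    by (rule continuous_on_subset[OF p(1)]) simp
  have i: "integrable lborel (\<lambda>x. indicator K x * p x)"
    using borel_integrable_compact[OF K pK] by (simp add: indicator_scaleR_eq_if[symmetric])
  have "emeasure (density lborel (\<lambda>x. ennreal (p x))) K = (\<integral>\<^sup>+x. ennreal (p x) * indicator K x \<partial>lborel)"
    using K by (intro emeasure_density) (auto intro: borel_compact)
  also have "\<dots> = (\<integral>\<^sup>+x. ennreal (indicator K x * p x) \<partial>lborel)"
    by (intro nn_integral_cong) (simp split: split_indicator)
  also have "\<dots> = ennreal (\<integral>x. indicator K x * p x \<partial>lborel)"
    using p by (intro nn_integral_eq_integral i) auto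
  also have "\<dots> = ennreal (integral K p)"
    by (simp add: integral_compact_eq_lborel(2)[OF K pK])
  finally show ?thesis .
qed

text \<open>
  If the function were positive at the point, it would be positive on a box around it, where a
  vanishing integral is impossible; the same applies to its negative.
\<close>

lemma continuous_zero_if_integrals_over_boxes_zero:
  fixes k :: "'a::euclidean_space \<Rightarrow> real"
  assumes k: "continuous_on UNIV k" and U: "open U" "x \<in> U"
    and zero: "\<And>a b. cbox a b \<subseteq> U \<Longrightarrow> integral (cbox a b) k = 0"
  shows "k x = 0"
proof -
  have "\<not> 0 < s x" if s: "continuous_on UNIV s"
    and sz: "\<And>a b. cbox a b \<subseteq> U \<Longrightarrow> integral (cbox a b) s = 0" for s :: "'a \<Rightarrow> real"
  proof
    assume pos: "0 < s x"
    have "open (U \<inter> {y. 0 < s y})"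
      by (intro open_Int U open_Collect_less s continuous_intros)
    moreover have "x \<in> U \<inter> {y. 0 < s y}"
      using U pos by simp
    ultimately obtain a b where ab: "cbox a b \<subseteq> U \<inter> {y. 0 < s y}" "x \<in> box a b"
      by (rule open_contains_cbox)
    have c: "continuous_on (cbox a b) s"
      by (rule continuous_on_subset[OF s]) simp
    have "integral (cbox a b) s = 0"
      using ab(1) by (intro sz) simp
    then have "(s has_integral 0) (cbox a b)"
      using integrable_integral[OF integrable_continuous[OF c]] by simp
    then have "s x = 0"
      using ab box_subset_cbox[of a b]
      by (intro has_integral_0_cbox_imp_0[OF c]) (auto intro: less_imp_le)
    with pos show False
      by simp
  qed
  from this[OF k zero] this[of "\<lambda>y. - k y"] show ?thesis
    using k zero by (simp add: continuous_on_minus)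
qed

text \<open>
  The critical values form a Lebesgue null set by Sard's theorem, hence are not charged by the image
  measure, which has a density; the preimage of that set contains every critical point. The
  set of critical values is first enlarged to a Borel null set, since the image measure is
  only defined on Borel sets.
\<close>

lemma pushforward_regular_points:
  fixes G :: "real^'n \<Rightarrow> real^'n" and A :: "real^'n \<Rightarrow> real^'n^'n"
  assumes G: "\<And>x. (G has_derivative (\<lambda>h. A x *v h)) (at x)"
    and push: "distr (density lborel p') borel G = density lborel q'"
    and [measurable]: "p' \<in> borel_measurable borel" "q' \<in> borel_measurable borel"
  shows "AE x in density lborel p'. det (A x) \<noteq> 0"
proof -
  have "negligible (G ` {x. det (A x) = 0})"
    by (rule Sard_critical_values_negligible[where g' = "\<lambda>x h. A x *v h"])
      (auto intro: G has_derivative_at_withinI)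
  then have "G ` {x. det (A x) = 0} \<in> null_sets lebesgue"
    by (simp add: negligible_iff_null_sets)
  from iffD1[OF null_sets_completion_iff2 this]
  obtain N where N: "N \<in> null_sets lborel" "G ` {x. det (A x) = 0} \<subseteq> N"
    by blast
  then have [measurable]: "N \<in> sets borel"
    by (auto dest: null_setsD2)
  have "continuous_on UNIV G"
    by (intro continuous_at_imp_continuous_on ballI has_derivative_continuous[OF G])
  then have [measurable]: "G \<in> borel_measurable borel"
    by (rule borel_measurable_continuous_onI)
  have "N \<in> null_sets (density lborel q')"
    using AE_not_in[OF N(1)] by (subst null_sets_density_iff) (auto elim: eventually_mono)
  then have "N \<in> null_sets (distr (density lborel p') borel G)"
    by (simp add: push)
  then have "G -` N \<in> null_sets (density lborel p')"
    by (subst (asm) null_sets_distr_iff) auto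
  then have "AE x in density lborel p'. x \<notin> G -` N"
    by (rule AE_not_in)
  then show ?thesis
    by (rule eventually_mono) (use N(2) in auto)
qed

text \<open>
  Let \<open>K\<close> be a box consisting of regular points. Injectivity says that \<open>K\<close> is the full preimage of
  \<open>G K\<close>, so the push-forward condition equates the integral of \<open>p\<close> over \<open>K\<close> with that of \<open>q\<close>
  over \<open>G K\<close>, and the change of variables formula pulls the latter back to \<open>K\<close>. Both integrands
  over \<open>K\<close> are continuous, so equality on all such boxes is equality at every regular point.
\<close>

lemma Monge_Ampere_at_regular_point:
  fixes G :: "real^'n \<Rightarrow> real^'n" and A :: "real^'n \<Rightarrow> real^'n^'n" and p q :: "real^'n \<Rightarrow> real"
  assumes G: "\<And>x. (G has_derivative (\<lambda>h. A x *v h)) (at x)"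
    and cont_det: "continuous_on UNIV (\<lambda>x. det (A x))"
    and inj: "\<And>x y. det (A x) \<noteq> 0 \<Longrightarrow> G x = G y \<Longrightarrow> y = x"
    and p: "continuous_on UNIV p" "\<And>x. 0 \<le> p x" and q: "continuous_on UNIV q" "\<And>x. 0 \<le> q x"
    and push: "distr (density lborel (\<lambda>x. ennreal (p x))) borel G = density lborel (\<lambda>x. ennreal (q x))"
    and x: "det (A x) \<noteq> 0"
  shows "p x = \<bar>det (A x)\<bar> * q (G x)"
proof -
  let ?U = "{x. det (A x) \<noteq> 0}" and ?k = "\<lambda>x. \<bar>det (A x)\<bar> * q (G x)"
  have cont_G: "continuous_on UNIV G"
    by (intro continuous_at_imp_continuous_on ballI has_derivative_continuous[OF G])
  then have [measurable]: "G \<in> borel_measurable borel"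
    by (rule borel_measurable_continuous_onI)
  have cont_k: "continuous_on UNIV ?k"
    by (rule continuous_on_mult[OF continuous_on_rabs[OF cont_det] continuous_on_compose2[OF q(1) cont_G]]) simp
  have "open ?U"
    by (rule open_Collect_neq[OF cont_det continuous_on_const])
  moreover have "integral (cbox a b) (\<lambda>x. p x - ?k x) = 0" if ab: "cbox a b \<subseteq> ?U" for a b
  proof -
    let ?K = "cbox a b"
    have GK: "compact (G ` ?K)"
      by (rule compact_continuous_image[OF continuous_on_subset[OF cont_G]]) auto
    have inj': "y = x" if "x \<in> ?K" "G x = G y" for x y
      by (rule inj) (use ab that in auto)
    have "y \<in> ?K" if "y \<in> G -` G ` ?K" for y
    proof -
      from that obtain x where "x \<in> ?K" "G x = G y"
        by auto
      with inj'[of x y] show ?thesis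
        by simp
    qed
    then have "G -` G ` ?K = ?K"
      by blast
    then have "emeasure (density lborel (\<lambda>x. ennreal (p x))) ?K =
        emeasure (distr (density lborel (\<lambda>x. ennreal (p x))) borel G) (G ` ?K)"
      using borel_compact[OF GK] by (simp add: emeasure_distr)
    then have "ennreal (integral ?K p) = ennreal (integral (G ` ?K) q)"
      by (simp add: push emeasure_density_lborel_compact p q GK)
    moreover have "0 \<le> integral ?K p" "0 \<le> integral (G ` ?K) q"
      using integral_compact_eq_lborel(2)[OF compact_cbox continuous_on_subset[OF p(1)]]
        integral_compact_eq_lborel(2)[OF GK continuous_on_subset[OF q(1)]]
      by (simp_all add: Bochner_Integration.integral_nonneg p q)
    ultimately have "integral ?K p = integral (G ` ?K) q"
      by simp
    also have "\<dots> = integral ?K (\<lambda>x. \<bar>det (matrix ((*v) (A x)))\<bar> * q (G x))"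
    proof (rule Jacobian_integral_compact)
      show "inj_on G ?K"
        by (rule inj_onI) (rule inj'[symmetric])
      show "(G has_derivative (*v) (A x)) (at x within ?K)" for x
        using G by (rule has_derivative_at_withinI)
      show "continuous_on ?K (\<lambda>x. det (matrix ((*v) (A x))))"
        using continuous_on_subset[OF cont_det] by simp
      show "continuous_on (G ` ?K) q"
        by (rule continuous_on_subset[OF q(1)]) simp
    qed simp
    finally have "integral ?K p = integral ?K ?k"
      by simp
    moreover have "p integrable_on ?K" "?k integrable_on ?K"
      by (intro integrable_continuous continuous_on_subset[OF p(1)] continuous_on_subset[OF cont_k]; simp)+
    ultimately show ?thesis
      by (simp add: Henstock_Kurzweil_Integration.integral_diff)
  qed
  moreover have "continuous_on UNIV (\<lambda>x. p x - ?k x)"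
    by (rule continuous_on_diff[OF p(1) cont_k])
  ultimately have "p x - ?k x = 0"
    using x by (intro continuous_zero_if_integrals_over_boxes_zero[of "\<lambda>x. p x - ?k x" ?U x]) simp_all
  then show ?thesis
    by simp
qed

section \<open>The Gaussian divergence of the inverse Hessian\<close>

text \<open>
  Here \<open>C k\<close> stands for the partial derivative in direction \<open>k\<close> of the matrix whose inverse is \<open>B\<close>.
  Both sides contract the tensor \<open>C\<close> with \<open>B\<close> twice, leaving one index free, but they
  contract different slots; they agree because \<open>C\<close> is symmetric in all three indices.
\<close>

lemma contracted_derivative_of_inverse:
  fixes B :: "real^'n^'n" and C :: "'n \<Rightarrow> real^'n^'n"
  assumes B: "transpose B = B"
    and C1: "\<And>k i j. C k $ i $ j = C i $ k $ j" and C2: "\<And>k i j. C k $ i $ j = C k $ j $ i"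
  shows "(\<Sum>i\<in>UNIV. (B ** C i ** B) $ i $ j) = (B *v (\<chi> k. trace (C k ** B))) $ j"
proof -
  have sym: "B $ a $ b = B $ b $ a" for a b
    using arg_cong[OF B, of "\<lambda>M. M $ a $ b"] by (simp add: transpose_def)
  have C: "C i $ l $ m = C m $ i $ l" for i l m
    using C1[of i m l] C2[of i l m] by simp
  have "(\<Sum>i\<in>UNIV. (B ** C i ** B) $ i $ j) =
      (\<Sum>i\<in>UNIV. \<Sum>m\<in>UNIV. (\<Sum>l\<in>UNIV. B $ i $ l * C i $ l $ m) * B $ m $ j)"
    by (simp add: matrix_matrix_mult_def)
  also have "\<dots> = (\<Sum>m\<in>UNIV. \<Sum>i\<in>UNIV. (\<Sum>l\<in>UNIV. B $ i $ l * C i $ l $ m) * B $ m $ j)"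
    by (rule sum.swap)
  also have "\<dots> = (\<Sum>m\<in>UNIV. B $ j $ m * (\<Sum>i\<in>UNIV. \<Sum>l\<in>UNIV. C m $ i $ l * B $ l $ i))"
  proof (rule sum.cong[OF refl])
    fix m
    have "(\<Sum>l\<in>UNIV. B $ i $ l * C i $ l $ m) = (\<Sum>l\<in>UNIV. C m $ i $ l * B $ l $ i)" for i
      by (rule sum.cong[OF refl]) (simp only: C[of i _ m] sym[of i] mult.commute)
    then show "(\<Sum>i\<in>UNIV. (\<Sum>l\<in>UNIV. B $ i $ l * C i $ l $ m) * B $ m $ j) =
        B $ j $ m * (\<Sum>i\<in>UNIV. \<Sum>l\<in>UNIV. C m $ i $ l * B $ l $ i)"
      by (simp only: sum_distrib_left[symmetric] sum_distrib_right[symmetric] sym[of j m] mult.commute)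
  qed
  also have "\<dots> = (B *v (\<chi> k. trace (C k ** B))) $ j"
    by (simp add: matrix_vector_mult_def matrix_matrix_mult_def trace_def)
  finally show ?thesis .
qed

lemma gauss_div_matrix_nth:
  fixes M :: "real^'n \<Rightarrow> real^'n^'n"
  assumes M: "(M has_derivative M') (at x)"
  shows "gauss_div_matrix M x $ j = (x v* M x) $ j - (\<Sum>i\<in>UNIV. M' (axis i 1) $ i $ j)"
proof -
  have "linear (\<lambda>A :: real^'n^'n. A *v axis j 1)"
    by (simp add: linear_iff matrix_vector_mult_add_rdistrib scaleR_matrix_vector_assoc)
  then have "((\<lambda>y. M y *v axis j 1) has_derivative (\<lambda>h. M' h *v axis j 1)) (at x)"
    by (intro bounded_linear.has_derivative[OF _ M]) (simp add: linear_conv_bounded_linear)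
  from frechet_derivative_at[OF this, symmetric] show ?thesis
    by (simp add: gauss_div_matrix_def gauss_div_def trace_def jacobian_def matrix_def
        matrix_vector_mult_basis column_def inner_vec_def vector_matrix_mult_def mult.commute)
qed

text \<open>
  The symmetry conditions say that \<open>A\<close> is a Hessian up to a constant matrix. They turn the
  Euclidean divergence of the inverse into the inverse applied to the vector of logarithmic
  derivatives of the determinant.
\<close>

lemma gauss_div_matrix_inverse:
  fixes A :: "real^'n \<Rightarrow> real^'n^'n"
  assumes A: "(A has_derivative A') (at x)" and nz: "det (A x) \<noteq> 0"
    and sym: "transpose (A x) = A x"
    and A'1: "\<And>k i j. A' (axis k 1) $ i $ j = A' (axis i 1) $ k $ j"
    and A'2: "\<And>k i j. A' (axis k 1) $ i $ j = A' (axis k 1) $ j $ i"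
  shows "gauss_div_matrix (\<lambda>y. matrix_inv (A y) - mat 1) x =
    matrix_inv (A x) *v (x + (\<chi> k. trace (A' (axis k 1) ** matrix_inv (A x)))) - x"
proof -
  let ?B = "matrix_inv (A x)"
  have B: "transpose ?B = ?B"
    by (rule transpose_matrix_inv[OF nz sym])
  have "((\<lambda>y. matrix_inv (A y) - mat 1) has_derivative (\<lambda>h. - (?B ** A' h ** ?B))) (at x)"
    using has_derivative_diff[OF has_derivative_matrix_inv[OF A nz] has_derivative_const[of "mat 1"]]
    by simp
  from gauss_div_matrix_nth[OF this]
  have div: "gauss_div_matrix (\<lambda>y. matrix_inv (A y) - mat 1) x $ j =
      (x v* (?B - mat 1)) $ j + (\<Sum>i\<in>UNIV. (?B ** A' (axis i 1) ** ?B) $ i $ j)" for j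
    by (simp add: sum_negf)
  have "transpose (?B - mat 1) = ?B - mat 1"
    using arg_cong[OF B, of "\<lambda>M. M - mat 1"] by (simp add: transpose_def vec_eq_iff mat_def eq_commute)
  then have "x v* (?B - mat 1) = (?B - mat 1) *v x"
    by (metis transpose_matrix_vector)
  also have "\<dots> = ?B *v x - x"
    by (simp add: matrix_vector_mult_diff_rdistrib)
  finally show ?thesis
    by (simp add: vec_eq_iff div contracted_derivative_of_inverse[OF B A'1 A'2] matrix_vector_right_distrib)
qed

section \<open>Differentiating the Monge--Ampere equation\<close>

text \<open>
  The equation is first brought into the form \<open>\<bar>det A\<bar> = exp L\<close> with
  \<open>L = f \<circ> G + \<bar>G\<bar>\<^sup>2 / 2 - \<bar>x\<bar>\<^sup>2 / 2 - ln c\<close>. It is then squared, which removes the absolute value and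
  with it any case distinction on the sign of the determinant, and differentiated.
\<close>

lemma log_Monge_Ampere_derivative:
  fixes f \<phi> :: "real^'n \<Rightarrow> real"
  assumes A_def: "A = (\<lambda>y. mat 1 + hessian \<phi> y)" and G_def: "G = (\<lambda>y. y + grad \<phi> y)"
    and f: "smooth f" and phi: "smooth \<phi>" and c: "0 < c"
    and MA: "\<And>y. det (A y) \<noteq> 0 \<Longrightarrow>
      exp (- inner y y / 2) = \<bar>det (A y)\<bar> * (c * exp (- f (G y) - inner (G y) (G y) / 2))"
    and x: "det (A x) \<noteq> 0"
  shows "inner (grad f (G x) + G x) (A x *v h) =
    inner x h + trace (hessian_derivative \<phi> x h ** matrix_inv (A x))"
proof -
  let ?t = "\<lambda>h. trace (hessian_derivative \<phi> x h ** matrix_inv (A x))"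
  define L where "L = (\<lambda>y. f (G y) + inner (G y) (G y) / 2 - inner y y / 2 - ln c)"
  have dA: "(A has_derivative hessian_derivative \<phi> y) (at y)" for y
    unfolding A_def
    using has_derivative_add[OF has_derivative_const[of "mat 1"] has_derivative_hessian[OF phi]] by simp
  have dG: "(G has_derivative (\<lambda>h. A y *v h)) (at y)" for y
    unfolding A_def G_def matrix_vector_mult_add_rdistrib matrix_vector_mul_lid
    by (intro has_derivative_add has_derivative_ident has_derivative_grad_hessian phi)
  have df: "((\<lambda>y. f (G y)) has_derivative (\<lambda>h. inner (grad f (G x)) (A x *v h))) (at x)"
    using diff_chain_at[OF dG has_derivative_grad[OF f]] by (simp add: o_def)
  have dL: "(L has_derivative (\<lambda>h. inner (grad f (G x) + G x) (A x *v h) - inner x h)) (at x)"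
    unfolding L_def
    by (auto intro!: derivative_eq_intros df dG
        simp: fun_eq_iff inner_add_left inner_add_right inner_commute)
  have "(\<lambda>y. det (A y)) differentiable (at x)"
    using has_derivative_det[OF dA x] unfolding differentiable_def by blast
  then have "isCont (\<lambda>y. det (A y)) x"
    by (rule differentiable_imp_continuous_within)
  then have "\<forall>\<^sub>F y in nhds x. det (A y) \<noteq> 0"
    using x by (auto simp: continuous_at eventually_nhds_conv_at intro: tendsto_imp_eventually_ne)
  then obtain U where U: "open U" "x \<in> U" "\<And>y. y \<in> U \<Longrightarrow> det (A y) \<noteq> 0"
    unfolding eventually_nhds by blast
  have eq: "(det (A y))\<^sup>2 = exp (2 * L y)" if "det (A y) \<noteq> 0" for y
  proof -
    define e where "e = - f (G y) - inner (G y) (G y) / 2"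
    have "L y = - inner y y / 2 - e - ln c"
      by (simp add: L_def e_def)
    then have "exp (L y) = exp (- inner y y / 2) / exp e / c"
      by (simp only: exp_diff exp_ln[OF c])
    then have "\<bar>det (A y)\<bar> = exp (L y)"
      unfolding MA[OF that] e_def[symmetric] using c by simp
    then have "(det (A y))\<^sup>2 = (exp (L y))\<^sup>2"
      by (metis power2_abs)
    then show ?thesis
      by (simp add: exp_double)
  qed
  have "((\<lambda>y. (det (A y))\<^sup>2) has_derivative (\<lambda>h. 2 * (det (A x))\<^sup>2 * ?t h)) (at x)"
    by (rule has_derivative_eq_rhs[OF has_derivative_power[OF has_derivative_det[OF dA x]]])
      (simp add: power2_eq_square mult.assoc fun_eq_iff)
  then have "((\<lambda>y. exp (2 * L y)) has_derivative (\<lambda>h. 2 * (det (A x))\<^sup>2 * ?t h)) (at x)"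
    by (rule has_derivative_transform_within_open[OF _ U(1,2)]) (rule eq[OF U(3)])
  moreover have "((\<lambda>y. exp (2 * L y)) has_derivative
      (\<lambda>h. 2 * (det (A x))\<^sup>2 * (inner (grad f (G x) + G x) (A x *v h) - inner x h))) (at x)"
    by (rule has_derivative_eq_rhs[OF has_derivative_exp[OF has_derivative_mult_right[OF dL]]])
      (simp add: eq[OF x] fun_eq_iff)
  ultimately have "(\<lambda>h. 2 * (det (A x))\<^sup>2 * ?t h) =
      (\<lambda>h. 2 * (det (A x))\<^sup>2 * (inner (grad f (G x) + G x) (A x *v h) - inner x h))"
    by (rule has_derivative_unique)
  from fun_cong[OF this, of h] show ?thesis
    using x by simp
qed

text \<open>
  As \<open>A x\<close> is symmetric, the logarithmic derivative of the Monge--Ampere equation in the coordinate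
  directions reads \<open>A x (\<nabla>f (G x) + G x) = x + w\<close>, where \<open>w\<close> is the vector of traces; the
  divergence term is the inverse of \<open>A x\<close> applied to the same \<open>x + w\<close>, minus \<open>x\<close>.
\<close>

lemma Euler_Lagrange_at_regular_point:
  fixes f \<phi> :: "real^'n \<Rightarrow> real"
  assumes A_def: "A = (\<lambda>y. mat 1 + hessian \<phi> y)" and G_def: "G = (\<lambda>y. y + grad \<phi> y)"
    and f: "smooth f" and phi: "smooth \<phi>" and c: "0 < c"
    and MA: "\<And>y. det (A y) \<noteq> 0 \<Longrightarrow>
      exp (- inner y y / 2) = \<bar>det (A y)\<bar> * (c * exp (- f (G y) - inner (G y) (G y) / 2))"
    and x: "det (A x) \<noteq> 0"
  shows "grad \<phi> x + grad f (G x) - gauss_div_matrix (\<lambda>y. matrix_inv (A y) - mat 1) x = 0"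
proof -
  let ?B = "matrix_inv (A x)"
  let ?w = "\<chi> k. trace (hessian_derivative \<phi> x (axis k 1) ** ?B)"
  have dA: "(A has_derivative hessian_derivative \<phi> x) (at x)"
    unfolding A_def
    using has_derivative_add[OF has_derivative_const[of "mat 1"] has_derivative_hessian[OF phi]] by simp
  have symA: "transpose (A x) = A x"
    using arg_cong[OF symmetric_hessian[OF phi, of x], of "\<lambda>M. mat 1 + M"]
    by (simp add: A_def transpose_def vec_eq_iff mat_def eq_commute)
  have "A x *v (grad f (G x) + G x) = x + ?w"
  proof (rule vec_eq_iff[THEN iffD2], rule allI)
    fix k
    have "(A x *v (grad f (G x) + G x)) $ k = inner (A x *v (grad f (G x) + G x)) (axis k 1)"
      by (simp add: inner_axis)
    also have "\<dots> = inner (transpose (A x) *v (grad f (G x) + G x)) (axis k 1)"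
      by (simp only: symA)
    also have "\<dots> = inner (grad f (G x) + G x) (A x *v axis k 1)"
      by (simp only: transpose_matrix_vector dot_lmul_matrix)
    also have "\<dots> = (x + ?w) $ k"
      using log_Monge_Ampere_derivative[OF A_def G_def f phi c MA x, of "axis k 1"]
      by (simp add: inner_axis)
    finally show "(A x *v (grad f (G x) + G x)) $ k = (x + ?w) $ k" .
  qed
  then have "?B *v (A x *v (grad f (G x) + G x)) = ?B *v (x + ?w)"
    by simp
  then have "grad f (G x) + G x = ?B *v (x + ?w)"
    by (simp only: matrix_vector_mul_assoc matrix_inv_right_left[OF x] matrix_vector_mul_lid)
  moreover have "gauss_div_matrix (\<lambda>y. matrix_inv (A y) - mat 1) x = ?B *v (x + ?w) - x"
    by (rule gauss_div_matrix_inverse[OF dA x symA]) (rule hessian_derivative_symmetric[OF phi])+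
  ultimately have "gauss_div_matrix (\<lambda>y. matrix_inv (A y) - mat 1) x = grad f (G x) + G x - x"
    by simp
  then show ?thesis
    by (simp add: G_def)
qed

section \<open>The transport map from the Gaussian measure\<close>

lemma prod_std_normal_density:
  fixes x :: "real^'n"
  shows "(\<Prod>i\<in>UNIV. std_normal_density (x $ i)) =
    (1 / sqrt (2 * pi)) ^ CARD('n) * exp (- inner x x / 2)"
proof -
  have "(\<Prod>i\<in>UNIV. std_normal_density (x $ i)) =
      (\<Prod>i\<in>(UNIV :: 'n set). 1 / sqrt (2 * pi)) * (\<Prod>i\<in>UNIV. exp (- (x $ i)\<^sup>2 / 2))"
    unfolding std_normal_density_def by (rule prod.distrib)
  also have "(\<Prod>i\<in>UNIV. exp (- (x $ i)\<^sup>2 / 2)) = exp (\<Sum>i\<in>UNIV. - (x $ i)\<^sup>2 / 2)"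
    by (simp add: exp_sum)
  also have "(\<Sum>i\<in>UNIV. - (x $ i)\<^sup>2 / 2) = - inner x x / 2"
    by (simp add: inner_vec_def power2_eq_square sum_divide_distrib sum_negf)
  finally show ?thesis
    by simp
qed

lemma has_derivative_half_norm_squared:
  fixes x :: "'a::real_inner"
  shows "((\<lambda>y. (norm y)\<^sup>2 / 2) has_derivative (\<lambda>h. inner x h)) (at x)"
  unfolding power2_norm_eq_inner by (auto intro!: derivative_eq_intros simp: inner_commute)

theorem theorem2:
  fixes f \<phi> :: "real^'n \<Rightarrow> real"
  assumes "smooth f"
    and "prob_space (gibbs f)"
    and "finite_relative_entropy (gibbs f) std_gaussian"
    and "Monge_potential std_gaussian (gibbs f) \<phi>"
    and "smooth \<phi>"
  shows "AE x in std_gaussian.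
    grad \<phi> x + grad f (x + grad \<phi> x)
      - gauss_div_matrix (\<lambda>y. matrix_inv (mat 1 + hessian \<phi> y) - mat 1) x = 0"
proof -
  define G where "G = (\<lambda>x. x + grad \<phi> x)"
  define A where "A = (\<lambda>x. mat 1 + hessian \<phi> x)"
  define Z where "Z = (\<integral>y. exp (- f y) \<partial>(std_gaussian :: (real^'n) measure))"
  define C where "C = (1 / sqrt (2 * pi)) ^ CARD('n)"
  define p where "p = (\<lambda>x :: real^'n. C * exp (- inner x x / 2))"
  define q where "q = (\<lambda>x. p x * (exp (- f x) / Z))"
  have C: "0 < C"
    by (simp add: C_def)
  have p: "continuous_on UNIV p" "\<And>x. 0 < p x"
    unfolding p_def using C by (auto intro!: continuous_intros)
  have [measurable]: "p \<in> borel_measurable borel"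
    by (rule borel_measurable_continuous_onI[OF p(1)])
  have cont_f: "continuous_on UNIV f"
    by (rule smooth_imp_continuous_on[OF assms(1)])
  have [measurable]: "f \<in> borel_measurable borel"
    by (rule borel_measurable_continuous_onI[OF cont_f])
  have gaussian: "std_gaussian = density lborel (\<lambda>x. ennreal (p x))"
    by (simp add: std_gaussian_def prod_std_normal_density p_def C_def)
  have gibbs: "gibbs f = density lborel (\<lambda>x. ennreal (q x))"
    unfolding gibbs_def Z_def[symmetric] unfolding gaussian
  proof (subst density_density_eq)
    have "ennreal (p x) * ennreal (exp (- f x) / Z) = ennreal (q x)" for x
      unfolding q_def by (rule ennreal_mult'[symmetric]) (simp add: p(2) less_imp_le)
    then show "density lborel (\<lambda>x. ennreal (p x) * ennreal (exp (- f x) / Z)) =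
        density lborel (\<lambda>x. ennreal (q x))"
      by simp
  qed simp_all
  have "0 \<le> Z"
    unfolding Z_def by (rule Bochner_Integration.integral_nonneg) simp
  \<comment> \<open>If \<open>e\<^sup>-\<^sup>f\<close> were not integrable, \<open>Z\<close> would be 0 and, division by 0 being 0, the Gibbs
    measure would be the null measure.\<close>
  moreover have "Z \<noteq> 0"
  proof
    assume "Z = 0"
    then have "emeasure (gibbs f) (space (gibbs f)) = 0"
      by (simp add: gibbs q_def emeasure_density)
    with prob_space.emeasure_space_1[OF assms(2)] show False
      by simp
  qed
  ultimately have Z: "0 < Z"
    by simp
  have q: "continuous_on UNIV q" "\<And>x. 0 \<le> q x"
    unfolding q_def using Z p(2)
    by (auto intro!: continuous_intros p(1) cont_f simp: less_imp_le)
  have [measurable]: "q \<in> borel_measurable borel"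
    by (rule borel_measurable_continuous_onI[OF q(1)])
  have dG: "(G has_derivative (\<lambda>h. A x *v h)) (at x)" for x
    unfolding A_def G_def matrix_vector_mult_add_rdistrib matrix_vector_mul_lid
    by (intro has_derivative_add has_derivative_ident has_derivative_grad_hessian assms)
  have "continuous_on UNIV A"
    unfolding A_def
    by (intro continuous_on_add continuous_on_const continuous_at_imp_continuous_on ballI
        has_derivative_continuous[OF has_derivative_hessian[OF assms(5)]])
  then have cont_det: "continuous_on UNIV (\<lambda>x. det (A x))"
    unfolding det_def by (intro continuous_intros)
  have convex: "convex_on UNIV (\<lambda>x. (norm x)\<^sup>2 / 2 + \<phi> x)"
    and push: "distr std_gaussian borel G = gibbs f"
    using assms(4) by (simp_all add: Monge_potential_def optimal_transport_map_def transport_map_def G_def)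
  have du: "((\<lambda>x. (norm x)\<^sup>2 / 2 + \<phi> x) has_derivative (\<lambda>h. inner (G x) h)) (at x)" for x
    unfolding G_def inner_add_left
    by (intro has_derivative_add has_derivative_half_norm_squared has_derivative_grad assms)
  have inj: "y = x" if "det (A x) \<noteq> 0" "G x = G y" for x y
    using convex du dG that by (rule convex_gradient_injective_at_regular_point)
  have push': "distr (density lborel (\<lambda>x. ennreal (p x))) borel G = density lborel (\<lambda>x. ennreal (q x))"
    using push by (simp only: gaussian gibbs)
  have MA: "exp (- inner y y / 2) = \<bar>det (A y)\<bar> * (1 / Z * exp (- f (G y) - inner (G y) (G y) / 2))"
    if "det (A y) \<noteq> 0" for y
  proof -
    have "p y = \<bar>det (A y)\<bar> * q (G y)"
      using dG cont_det inj p(1) less_imp_le[OF p(2)] q push' that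
      by (rule Monge_Ampere_at_regular_point)
    then have "C * exp (- inner y y / 2) =
        C * (\<bar>det (A y)\<bar> * (1 / Z * (exp (- f (G y)) * exp (- inner (G y) (G y) / 2))))"
      by (simp add: p_def q_def mult_ac)
    moreover have "C \<noteq> 0"
      using C by simp
    ultimately have "exp (- inner y y / 2) =
        \<bar>det (A y)\<bar> * (1 / Z * (exp (- f (G y)) * exp (- inner (G y) (G y) / 2)))"
      using mult_left_cancel by blast
    then show ?thesis
      using exp_add[of "- f (G y)" "- inner (G y) (G y) / 2"] by simp
  qed
  have "AE x in std_gaussian. det (A x) \<noteq> 0"
    unfolding gaussian
    by (rule pushforward_regular_points[OF dG push']) measurable
  then show ?thesis
  proof (rule eventually_mono)
    fix x
    assume "det (A x) \<noteq> 0"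
    have "0 < 1 / Z"
      using Z by simp
    from Euler_Lagrange_at_regular_point[OF A_def G_def assms(1,5) this MA \<open>det (A x) \<noteq> 0\<close>]
    show "grad \<phi> x + grad f (x + grad \<phi> x)
        - gauss_div_matrix (\<lambda>y. matrix_inv (mat 1 + hessian \<phi> y) - mat 1) x = 0"
      by (simp add: A_def G_def)
  qed
qed

end
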